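(* Let $R$ be a (commutative) field and let $X$ be a finite precubical set such that, for all $v,w\in X_0$ and all $m\ge0$, all cube chains of dimension $m$ from $v$ to $w$ have the same length. Let $i,j\ge1$ and let $\alpha,\beta,\gamma\in X_0$ be such that $\beta$ is reachable from $\alpha$ and $\gamma$ is reachable from $\beta$. Then concatenation $\otimes$ of cube chains induces a well-defined $R$-linear map (conc-product) $$\circledast:\ HM_i[X]_\alpha^\beta\otimes_R HM_j[X]_\beta^\gamma\longrightarrow HM_{i+j-1}[X]_\alpha^\gamma,\qquad [c]\circledast[d]=[c\otimes d].$$
   Context: **Precubical sets.** A precubical set $X$ is a family of sets $(X_n)_{n\ge0}$ with face maps $d^\epsilon_i:X_n\to X_{n-1}$ ($\epsilon\in\{0,1\}$, $1\le i\le n$) such that $d^\epsilon_i d^\eta_j=d^\eta_{j-1}d^\epsilon_i$ for $i<j$. It is finite if $\bigcup_n X_n$ is finite. For $A=\{a_1<\dots<a_r\}\subseteq\{1,\dots,n\}$ and $c\in X_n$, put $d^\epsilon_A(c)=d^\epsilon_{a_1}\cdots d^\epsilon_{a_r}(c)\in X_{n-r}$, and $d^\epsilon(c)=d^\epsilon_{\{1,\dots,n\}}(c)\in X_0$ (start vertex for $\epsilon=0$, end vertex for $\epsilon=1$). **Cube chains.** A cube chain from $v\in X_0$ to $w\in X_0$ is a sequence $c=(c_1,\dots,c_l)_{v,w}$, $l\ge0$, with $c_k\in X_{n_k}$, $n_k>0$, such that either $l=0$ and $v=w$, or $d^0(c_1)=v$, $d^1(c_l)=w$ and $d^1(c_k)=d^0(c_{k+1})$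 for $1\le k<l$. Its dimension is $n_1+\dots+n_l-l$ and its length is $n_1+\dots+n_l$ (both $0$ when $l=0$). A vertex $w$ is reachable from $v$ if there is a cube chain of dimension $0$ from $v$ to $w$. **Chain complex and homology.** For $i\ge0$, $R_{i+1}[X]_v^w$ is the free $R$-module on the cube chains of dimension $i$ from $v$ to $w$. For $1\le k\le l$ and $\mathcal I\subseteq\{1,\dots,n_k\}$ with $0<|\mathcal I|<n_k$, let $$d_{k,\mathcal I}(c)=(c_1,\dots,c_{k-1},d^0_{\overline{\mathcal I}}(c_k),d^1_{\mathcal I}(c_k),c_{k+1},\dots,c_l),\qquad \overline{\mathcal I}=\{1,\dots,n_k\}\setminus\mathcal I .$$ The boundary $\partial:R_{i+1}[X]_v^w\to R_i[X]_v^w$ ($i\ge1$) is the linear map with $$\partial c=\sum_{k=1}^l\sum_{r=1}^{n_k-1}\ \sum_{|\mathcal I|=r}(-1)^{n_1+\dots+n_{k-1}+k+r+1}\,\mathrm{sgn}(\mathcal I)\,d_{k,\mathcal I}(c),$$ where $\mathrm{sgn}(\mathcal I)=1$ if $\sum_{j\in\mathcal I}j\equiv\sum_{j=1}^r j\pmod 2$ and $-1$ otherwise. One has $\partial^2=0$; $\partial=0$ on $R_1[X]_v^w$. For $n\ge1$, $HM_n[X]_v^w=\ker(\partial|_{R_n[X]_v^w})/\mathrm{im}(\partial|_{R_{n+1}[X]_v^w})$. **Concatenation.** For cube chains $c=(c_1,\dots,c_n)$ from $\alpha$ to $\beta$ and $d=(d_1,\dots,d_m)$ from $\beta$ to $\gamma$,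 $c\otimes d=(c_1,\dots,c_n,d_1,\dots,d_m)$, a cube chain from $\alpha$ to $\gamma$. Extended bilinearly, this gives $\otimes:R_i[X]_\alpha^\beta\times R_j[X]_\beta^\gamma\to R_{i+j-1}[X]_\alpha^\gamma$. *)

theory Defs
  imports "HOL-Algebra.Module" "HOL-Algebra.AbelCoset"
begin

text \<open>As for other modules without a ring multiplication, the fields \<open>mult\<close> and \<open>one\<close>
  inherited from the record type of rings are irrelevant.\<close>

definition free_module :: "('r, 'm) ring_scheme \<Rightarrow> 'b set \<Rightarrow> ('r, 'b \<Rightarrow> 'r) module" where
  "free_module R B =
    \<lparr>carrier = {f. (\<forall>b. f b \<in> carrier R) \<and> (\<forall>b. b \<notin> B \<longrightarrow> f b = \<zero>\<^bsub>R\<^esub>) \<and> finite {b. f b \<noteq> \<zero>\<^bsub>R\<^esub>}},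
     mult = undefined, one = undefined,
     zero = (\<lambda>b. \<zero>\<^bsub>R\<^esub>),
     add = (\<lambda>f g b. f b \<oplus>\<^bsub>R\<^esub> g b),
     smult = (\<lambda>a f b. a \<otimes>\<^bsub>R\<^esub> f b)\<rparr>"

definition basis_elt :: "('r, 'm) ring_scheme \<Rightarrow> 'b \<Rightarrow> 'b \<Rightarrow> 'r" where
  "basis_elt R b = (\<lambda>b'. if b' = b then \<one>\<^bsub>R\<^esub> else \<zero>\<^bsub>R\<^esub>)"

definition quotient_module :: "('r, 'b, 'm) module_scheme \<Rightarrow> 'b set \<Rightarrow> ('r, 'b set) module" where
  "quotient_module M N =
    \<lparr>carrier = a_rcosets\<^bsub>M\<^esub> N,
     mult = undefined, one = undefined,
     zero = N,
     add = set_add M,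
     smult = (\<lambda>a C. \<Union>x\<in>C. N +>\<^bsub>M\<^esub> (a \<odot>\<^bsub>M\<^esub> x))\<rparr>"

definition submodule_generated ::
  "('r, 'm) ring_scheme \<Rightarrow> ('r, 'b, 'n) module_scheme \<Rightarrow> 'b set \<Rightarrow> 'b set" where
  "submodule_generated R M S = \<Inter>{H. submodule H R M \<and> S \<subseteq> H}"

definition tensor_relations ::
  "('r, 'm) ring_scheme \<Rightarrow> ('r, 'b, 'n) module_scheme \<Rightarrow> ('r, 'c, 'k) module_scheme \<Rightarrow>
    ('b \<times> 'c \<Rightarrow> 'r) set" where
  "tensor_relations R M N =
    (let F = free_module R (carrier M \<times> carrier N); e = (\<lambda>x y. basis_elt R (x, y)) in
      {e (x \<oplus>\<^bsub>M\<^esub> x') y \<ominus>\<^bsub>F\<^esub> (e x y \<oplus>\<^bsub>F\<^esub> e x' y) | x x' y.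
         x \<in> carrier M \<and> x' \<in> carrier M \<and> y \<in> carrier N} \<union>
      {e x (y \<oplus>\<^bsub>N\<^esub> y') \<ominus>\<^bsub>F\<^esub> (e x y \<oplus>\<^bsub>F\<^esub> e x y') | x y y'.
         x \<in> carrier M \<and> y \<in> carrier N \<and> y' \<in> carrier N} \<union>
      {e (a \<odot>\<^bsub>M\<^esub> x) y \<ominus>\<^bsub>F\<^esub> a \<odot>\<^bsub>F\<^esub> e x y | a x y.
         a \<in> carrier R \<and> x \<in> carrier M \<and> y \<in> carrier N} \<union>
      {e x (a \<odot>\<^bsub>N\<^esub> y) \<ominus>\<^bsub>F\<^esub> a \<odot>\<^bsub>F\<^esub> e x y | a x y.
         a \<in> carrier R \<and> x \<in> carrier M \<and> y \<in> carrier N})"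

definition tensor_kernel ::
  "('r, 'm) ring_scheme \<Rightarrow> ('r, 'b, 'n) module_scheme \<Rightarrow> ('r, 'c, 'k) module_scheme \<Rightarrow>
    ('b \<times> 'c \<Rightarrow> 'r) set" where
  "tensor_kernel R M N =
    submodule_generated R (free_module R (carrier M \<times> carrier N)) (tensor_relations R M N)"

definition tensor_product ::
  "('r, 'm) ring_scheme \<Rightarrow> ('r, 'b, 'n) module_scheme \<Rightarrow> ('r, 'c, 'k) module_scheme \<Rightarrow>
    ('r, ('b \<times> 'c \<Rightarrow> 'r) set) module" where
  "tensor_product R M N =
    quotient_module (free_module R (carrier M \<times> carrier N)) (tensor_kernel R M N)"

definition pure_tensor ::
  "('r, 'm) ring_scheme \<Rightarrow> ('r, 'b, 'n) module_scheme \<Rightarrow> ('r, 'c, 'k) module_scheme \<Rightarrow>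
    'b \<Rightarrow> 'c \<Rightarrow> ('b \<times> 'c \<Rightarrow> 'r) set" where
  "pure_tensor R M N x y =
    tensor_kernel R M N +>\<^bsub>free_module R (carrier M \<times> carrier N)\<^esub> basis_elt R (x, y)"

text \<open>Linear maps are taken extensional (\<open>undefined\<close> outside the carrier of the domain), so that
  equality of functions is equality of linear maps.\<close>

definition linear_maps ::
  "('r, 'm) ring_scheme \<Rightarrow> ('r, 'b, 'n) module_scheme \<Rightarrow> ('r, 'c, 'k) module_scheme \<Rightarrow>
    ('b \<Rightarrow> 'c) set" where
  "linear_maps R M N =
    {h \<in> carrier M \<rightarrow>\<^sub>E carrier N.
      (\<forall>x\<in>carrier M. \<forall>y\<in>carrier M. h (x \<oplus>\<^bsub>M\<^esub> y) = h x \<oplus>\<^bsub>N\<^esub> h y) \<and>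
      (\<forall>a\<in>carrier R. \<forall>x\<in>carrier M. h (a \<odot>\<^bsub>M\<^esub> x) = a \<odot>\<^bsub>N\<^esub> h x)}"

text \<open>\<open>face X \<epsilon> n i\<close> is the face map \<open>d\<^sup>\<epsilon>\<^sub>i : X\<^sub>n \<rightarrow> X\<^bsub>n-1\<^esub>\<close>; \<open>False\<close> and \<open>True\<close> stand for
  \<open>\<epsilon> = 0\<close> and \<open>\<epsilon> = 1\<close>. The sets \<open>cells X n\<close> need not be disjoint, hence the explicit \<open>n\<close>.\<close>

record 'a precubical =
  cells :: "nat \<Rightarrow> 'a set"
  face :: "bool \<Rightarrow> nat \<Rightarrow> nat \<Rightarrow> 'a \<Rightarrow> 'a"

locale precubical_set =
  fixes X :: "'a precubical"
  assumes face_closed: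
      "\<lbrakk>1 \<le> i; i \<le> n; x \<in> cells X n\<rbrakk> \<Longrightarrow> face X \<epsilon> n i x \<in> cells X (n - 1)"
    and face_face:
      "\<lbrakk>1 \<le> i; i < j; j \<le> n; x \<in> cells X n\<rbrakk> \<Longrightarrow>
        face X \<epsilon> (n - 1) i (face X \<eta> n j x) = face X \<eta> (n - 1) (j - 1) (face X \<epsilon> n i x)"

definition finite_precubical :: "'a precubical \<Rightarrow> bool" where
  "finite_precubical X \<longleftrightarrow> finite (\<Union>n. cells X n)"

text \<open>\<open>face_list X \<epsilon> n [a\<^sub>1, \<dots>, a\<^sub>r] x = d\<^sup>\<epsilon> a\<^sub>1 (\<dots> (d\<^sup>\<epsilon> a\<^sub>r x))\<close> for \<open>x\<close> of dimension \<open>n\<close>: the last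
  index is applied first, in dimension \<open>n\<close>.\<close>

fun face_list :: "'a precubical \<Rightarrow> bool \<Rightarrow> nat \<Rightarrow> nat list \<Rightarrow> 'a \<Rightarrow> 'a" where
  "face_list X \<epsilon> n [] x = x"
| "face_list X \<epsilon> n (a # as) x = face X \<epsilon> (n - length as) a (face_list X \<epsilon> n as x)"

definition face_set :: "'a precubical \<Rightarrow> bool \<Rightarrow> nat \<Rightarrow> nat set \<Rightarrow> 'a \<Rightarrow> 'a" where
  "face_set X \<epsilon> n A x = face_list X \<epsilon> n (sorted_list_of_set A) x"

definition end_vertex :: "'a precubical \<Rightarrow> bool \<Rightarrow> nat \<times> 'a \<Rightarrow> 'a" where
  "end_vertex X \<epsilon> = (\<lambda>(n, x). face_set X \<epsilon> n {1..n} x)"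

text \<open>A cube is recorded together with its dimension, as \<open>(n\<^sub>k, c\<^sub>k)\<close>. The endpoints \<open>v\<close> and \<open>w\<close> are
  not part of the list; only for the empty chain are they not determined by it.\<close>

type_synonym 'a cchain = "(nat \<times> 'a) list"

definition cube_chains :: "'a precubical \<Rightarrow> 'a \<Rightarrow> 'a \<Rightarrow> 'a cchain set" where
  "cube_chains X v w =
    {c. v \<in> cells X 0 \<and> w \<in> cells X 0 \<and>
        (\<forall>(n, x)\<in>set c. n > 0 \<and> x \<in> cells X n) \<and>
        (if c = [] then v = w
         else end_vertex X False (hd c) = v \<and> end_vertex X True (last c) = w \<and>
              (\<forall>k. Suc k < length c \<longrightarrow>
                end_vertex X True (c ! k) = end_vertex X False (c ! Suc k)))}"

definition chain_length :: "'a cchain \<Rightarrow> nat" where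
  "chain_length c = sum_list (map fst c)"

definition chain_dim :: "'a cchain \<Rightarrow> nat" where
  "chain_dim c = chain_length c - length c"

definition reachable :: "'a precubical \<Rightarrow> 'a \<Rightarrow> 'a \<Rightarrow> bool" where
  "reachable X v w \<longleftrightarrow> (\<exists>c\<in>cube_chains X v w. chain_dim c = 0)"

text \<open>\<open>chain_module R X n v w\<close> is \<open>R\<^sub>n[X]\<close>, generated in degree \<open>n\<close> by the cube chains of dimension
  \<open>n - 1\<close>. In degree \<open>0\<close> it is the zero module, so \<open>\<partial> = 0\<close> in degree \<open>1\<close>.\<close>

definition chain_module ::
  "('r, 'm) ring_scheme \<Rightarrow> 'a precubical \<Rightarrow> nat \<Rightarrow> 'a \<Rightarrow> 'a \<Rightarrow> ('r, 'a cchain \<Rightarrow> 'r) module" where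
  "chain_module R X n v w = free_module R {c \<in> cube_chains X v w. chain_dim c + 1 = n}"

text \<open>In \<open>split_chain X k I c\<close> the position \<open>k\<close> is counted from \<open>1\<close>.\<close>

definition split_chain :: "'a precubical \<Rightarrow> nat \<Rightarrow> nat set \<Rightarrow> 'a cchain \<Rightarrow> 'a cchain" where
  "split_chain X k I c =
    (let (n, x) = c ! (k - 1) in
      take (k - 1) c @
      [(card I, face_set X False n ({1..n} - I) x), (n - card I, face_set X True n I x)] @
      drop k c)"

definition subset_sign :: "('r, 'm) ring_scheme \<Rightarrow> nat set \<Rightarrow> 'r" where
  "subset_sign R I =
    (if (\<Sum>j\<in>I. j) mod 2 = (\<Sum>j=1..card I. j) mod 2 then \<one>\<^bsub>R\<^esub> else \<ominus>\<^bsub>R\<^esub> \<one>\<^bsub>R\<^esub>)"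

definition boundary_chain ::
  "('r, 'm) ring_scheme \<Rightarrow> 'a precubical \<Rightarrow> nat \<Rightarrow> 'a \<Rightarrow> 'a \<Rightarrow> 'a cchain \<Rightarrow> 'a cchain \<Rightarrow> 'r" where
  "boundary_chain R X n v w c =
    (let M = chain_module R X (n - 1) v w; dim = (\<lambda>k. fst (c ! (k - 1))) in
      \<Oplus>\<^bsub>M\<^esub>k\<in>{1..length c}. \<Oplus>\<^bsub>M\<^esub>r\<in>{1..dim k - 1}. \<Oplus>\<^bsub>M\<^esub>I\<in>{I. I \<subseteq> {1..dim k} \<and> card I = r}.
        (((\<ominus>\<^bsub>R\<^esub> \<one>\<^bsub>R\<^esub>) [^]\<^bsub>R\<^esub> ((\<Sum>p=1..<k. dim p) + k + r + 1)) \<otimes>\<^bsub>R\<^esub> subset_sign R I)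
          \<odot>\<^bsub>M\<^esub> basis_elt R (split_chain X k I c))"

text \<open>The boundary map \<open>R\<^sub>n[X] \<rightarrow> R\<^bsub>n-1\<^esub>[X]\<close>, for \<open>n \<ge> 1\<close>.\<close>

definition boundary ::
  "('r, 'm) ring_scheme \<Rightarrow> 'a precubical \<Rightarrow> nat \<Rightarrow> 'a \<Rightarrow> 'a \<Rightarrow>
    ('a cchain \<Rightarrow> 'r) \<Rightarrow> 'a cchain \<Rightarrow> 'r" where
  "boundary R X n v w f =
    (let M = chain_module R X (n - 1) v w in
      \<Oplus>\<^bsub>M\<^esub>c\<in>{c. f c \<noteq> \<zero>\<^bsub>R\<^esub>}. f c \<odot>\<^bsub>M\<^esub> boundary_chain R X n v w c)"

definition cycles ::
  "('r, 'm) ring_scheme \<Rightarrow> 'a precubical \<Rightarrow> nat \<Rightarrow> 'a \<Rightarrow> 'a \<Rightarrow> ('a cchain \<Rightarrow> 'r) set" where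
  "cycles R X n v w =
    {f \<in> carrier (chain_module R X n v w).
      boundary R X n v w f = \<zero>\<^bsub>chain_module R X (n - 1) v w\<^esub>}"

definition boundaries ::
  "('r, 'm) ring_scheme \<Rightarrow> 'a precubical \<Rightarrow> nat \<Rightarrow> 'a \<Rightarrow> 'a \<Rightarrow> ('a cchain \<Rightarrow> 'r) set" where
  "boundaries R X n v w = boundary R X (n + 1) v w ` carrier (chain_module R X (n + 1) v w)"

definition HM ::
  "('r, 'm) ring_scheme \<Rightarrow> 'a precubical \<Rightarrow> nat \<Rightarrow> 'a \<Rightarrow> 'a \<Rightarrow>
    ('r, ('a cchain \<Rightarrow> 'r) set) module" where
  "HM R X n v w =
    quotient_module (chain_module R X n v w\<lparr>carrier := cycles R X n v w\<rparr>) (boundaries R X n v w)"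

definition homology_class ::
  "('r, 'm) ring_scheme \<Rightarrow> 'a precubical \<Rightarrow> nat \<Rightarrow> 'a \<Rightarrow> 'a \<Rightarrow>
    ('a cchain \<Rightarrow> 'r) \<Rightarrow> ('a cchain \<Rightarrow> 'r) set" where
  "homology_class R X n v w f = boundaries R X n v w +>\<^bsub>chain_module R X n v w\<^esub> f"

text \<open>The bilinear extension
  \<open>R\<^sub>i[X]\<^sub>\<alpha>\<^sup>\<beta> \<times> R\<^sub>j[X]\<^sub>\<beta>\<^sup>\<gamma> \<rightarrow> R\<^bsub>i+j-1\<^esub>[X]\<^sub>\<alpha>\<^sup>\<gamma>\<close> of concatenation;
  the formula does not depend on the middle vertex.\<close>

definition concat_chains ::
  "('r, 'm) ring_scheme \<Rightarrow> 'a precubical \<Rightarrow> nat \<Rightarrow> nat \<Rightarrow> 'a \<Rightarrow> 'a \<Rightarrow>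
    ('a cchain \<Rightarrow> 'r) \<Rightarrow> ('a cchain \<Rightarrow> 'r) \<Rightarrow> 'a cchain \<Rightarrow> 'r" where
  "concat_chains R X i j \<alpha> \<gamma> f g =
    (let M = chain_module R X (i + j - 1) \<alpha> \<gamma> in
      \<Oplus>\<^bsub>M\<^esub>c\<in>{c. f c \<noteq> \<zero>\<^bsub>R\<^esub>}. \<Oplus>\<^bsub>M\<^esub>d\<in>{d. g d \<noteq> \<zero>\<^bsub>R\<^esub>}.
        (f c \<otimes>\<^bsub>R\<^esub> g d) \<odot>\<^bsub>M\<^esub> basis_elt R (c @ d))"

end

theory Submission
  imports Defs
begin

text \<open>Everything follows from the Leibniz rule
  \<open>\<partial>(c \<otimes> d) = \<partial>c \<otimes> d + (-1)\<^bsup>i-1\<^esup> c \<otimes> \<partial>d\<close> for \<open>c\<close> in degree \<open>i\<close>. Splitting a cube of \<open>c \<otimes> d\<close> splits a cube of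
  \<open>c\<close> or one of \<open>d\<close>; in the second case the sign of the boundary changes by \<open>(-1)\<close> to the length of
  \<open>c\<close> plus its number of cubes, and this exponent has the parity of the dimension \<open>i - 1\<close> of \<open>c\<close>.
  So products of cycles are cycles, and a product of a cycle and a boundary is a boundary; the
  resulting bilinear map on homology factors through the tensor product.\<close>

text \<open>Both sides of the Leibniz rule are bilinear, so it suffices to compare them on pairs of
  basis chains, where it becomes a statement about the terms of finite sums. For this,
  \<open>boundary\<close> and \<open>concat_chains\<close> are recognised as linear extensions of
  maps given on bases. The sums are formed inside a chain module and obey the usual laws only for
  summands in its carrier. This is where the geometry enters: splitting a cube must yield a chain
  with the same endpoints and one dimension less, which rests on the fact that the two complementary
  faces of a cube meet in a vertex. The chain module in degree 0 is zero, so the rule keeps its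
  meaning when a factor has degree 1. The sign in the rule is its own inverse, so it can be
  cancelled when the second factor is a boundary. Homology classes are cosets, so their product is
  defined through chosen representatives; independence of the choice is settled beforehand on
  cycles.\<close>

section \<open>Modules\<close>

text \<open>The functions in \<open>linear_maps\<close>, but without their values outside the domain being fixed.\<close>

definition module_hom ::
  "('r, 'm) ring_scheme \<Rightarrow> ('r, 'b, 'n) module_scheme \<Rightarrow> ('r, 'c, 'k) module_scheme \<Rightarrow>
    ('b \<Rightarrow> 'c) set" where
  "module_hom R M N =
    {h \<in> carrier M \<rightarrow> carrier N.
      (\<forall>x\<in>carrier M. \<forall>y\<in>carrier M. h (x \<oplus>\<^bsub>M\<^esub> y) = h x \<oplus>\<^bsub>N\<^esub> h y) \<and>
      (\<forall>a\<in>carrier R. \<forall>x\<in>carrier M. h (a \<odot>\<^bsub>M\<^esub> x) = a \<odot>\<^bsub>N\<^esub> h x)}"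

lemma module_homI:
  assumes "\<And>x. x \<in> carrier M \<Longrightarrow> h x \<in> carrier N"
    and "\<And>x y. x \<in> carrier M \<Longrightarrow> y \<in> carrier M \<Longrightarrow> h (x \<oplus>\<^bsub>M\<^esub> y) = h x \<oplus>\<^bsub>N\<^esub> h y"
    and "\<And>a x. a \<in> carrier R \<Longrightarrow> x \<in> carrier M \<Longrightarrow> h (a \<odot>\<^bsub>M\<^esub> x) = a \<odot>\<^bsub>N\<^esub> h x"
  shows "h \<in> module_hom R M N"
  using assms by (auto simp: module_hom_def)

lemma module_homD:
  assumes "h \<in> module_hom R M N"
  shows "x \<in> carrier M \<Longrightarrow> h x \<in> carrier N"
    and "x \<in> carrier M \<Longrightarrow> y \<in> carrier M \<Longrightarrow> h (x \<oplus>\<^bsub>M\<^esub> y) = h x \<oplus>\<^bsub>N\<^esub> h y"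
    and "a \<in> carrier R \<Longrightarrow> x \<in> carrier M \<Longrightarrow> h (a \<odot>\<^bsub>M\<^esub> x) = a \<odot>\<^bsub>N\<^esub> h x"
  using assms by (auto simp: module_hom_def)

text \<open>Homomorphisms are constrained only on the carrier. This matters for
  \<open>concat_chains\<close>, whose description as an iterated linear extension is proved only on
  the chain modules.\<close>

lemma module_hom_cong:
  assumes "h \<in> module_hom R M N" "\<And>x. x \<in> carrier M \<Longrightarrow> k x = h x" "module R M"
  shows "k \<in> module_hom R M N"
proof -
  interpret module R M by fact
  show ?thesis
    by (rule module_homI) (simp_all add: assms(2) module_homD[OF assms(1)])
qed

lemma module_hom_comp:
  "h \<in> module_hom R M N \<Longrightarrow> k \<in> module_hom R N P \<Longrightarrow> (\<lambda>x. k (h x)) \<in> module_hom R M P"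
  by (auto simp: module_hom_def Pi_iff)

lemma module_hom_group_hom:
  assumes "module R M" "module R N" "h \<in> module_hom R M N"
  shows "abelian_group_hom M N h"
  using assms by (intro abelian_group_homI) (auto simp: module_def module_hom_def hom_def abelian_group.axioms
      intro!: group_hom.intro group_hom_axioms.intro abelian_group.a_group)

lemma module_hom_zero:
  assumes "module R M" "module R N" "h \<in> module_hom R M N"
  shows "h \<zero>\<^bsub>M\<^esub> = \<zero>\<^bsub>N\<^esub>"
  using abelian_group_hom.hom_zero[OF module_hom_group_hom[OF assms]] .

lemma module_hom_finsum:
  assumes "module R M" "module R N" "h \<in> module_hom R M N"
    and "f \<in> A \<rightarrow> carrier M"
  shows "h (\<Oplus>\<^bsub>M\<^esub>x\<in>A. f x) = (\<Oplus>\<^bsub>N\<^esub>x\<in>A. h (f x))"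
proof -
  interpret M: module R M by fact
  interpret N: module R N by fact
  show ?thesis using assms(4)
  proof (induction A rule: infinite_finite_induct)
    \<comment> \<open>A sum over an infinite set is zero by convention, so this case is preservation
      of zero, like the empty one.\<close>
    case (infinite A)
    then show ?case by (simp add: module_hom_zero[OF assms(1-3)])
  next
    case empty
    then show ?case by (simp add: module_hom_zero[OF assms(1-3)])
  next
    case (insert x A)
    then have "f x \<in> carrier M" "f \<in> A \<rightarrow> carrier M" by auto
    moreover have "(\<lambda>x. h (f x)) \<in> A \<rightarrow> carrier N" "h (f x) \<in> carrier N"
      using calculation module_homD(1)[OF assms(3)] by auto
    ultimately show ?case
      using insert M.finsum_closed[of f A] by (simp add: module_homD(2)[OF assms(3)])
  qed
qed

lemma module_hom_add:
  assumes "module R N" "h \<in> module_hom R M N" "k \<in> module_hom R M N"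
  shows "(\<lambda>x. h x \<oplus>\<^bsub>N\<^esub> k x) \<in> module_hom R M N"
proof -
  interpret N: module R N by fact
  note h = module_homD[OF assms(2)] and k = module_homD[OF assms(3)]
  show ?thesis
    by (rule module_homI) (simp_all add: h k N.smult_r_distr N.M.a_ac)
qed

text \<open>Scaling by b commutes with the other scalars because R is commutative. With a sign as b,
  it makes the signed term of the Leibniz rule linear.\<close>

lemma module_hom_smult:
  assumes "module R N" "h \<in> module_hom R M N" "b \<in> carrier R"
  shows "(\<lambda>x. b \<odot>\<^bsub>N\<^esub> h x) \<in> module_hom R M N"
proof -
  interpret N: module R N by fact
  note h = module_homD[OF assms(2)]
  show ?thesis
    by (rule module_homI)
      (simp_all add: h assms N.smult_r_distr N.smult_assoc1[symmetric] N.R.m_comm)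
qed

text \<open>Elements of N lift to M, so each axiom of N is the image under h of the same axiom of M.
  Preservation of zero is a hypothesis because its usual proof cancels in N, which is not yet known
  to be a group.\<close>

lemma module_surj_image:
  fixes R :: "('r, 'm) ring_scheme" and M :: "('r, 'b, 'n) module_scheme"
    and N :: "('r, 'c, 'k) module_scheme"
  assumes "module R M" and h: "h \<in> module_hom R M N"
    and surj: "carrier N = h ` carrier M" and zero: "h \<zero>\<^bsub>M\<^esub> = \<zero>\<^bsub>N\<^esub>"
  shows "module R N"
proof -
  interpret M: module R M by fact
  note h = module_homD(2,3)[OF h, symmetric]
  show ?thesis
  proof (rule moduleI)
    show "cring R" by (rule M.R.is_cring)
    show "abelian_group N"
    proof (rule abelian_groupI)
      show "x \<oplus>\<^bsub>N\<^esub> y \<in> carrier N" if "x \<in> carrier N" "y \<in> carrier N" for x y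
        using that by (auto simp: surj h)
      show "\<zero>\<^bsub>N\<^esub> \<in> carrier N"
        by (auto simp: surj zero[symmetric])
      show "(x \<oplus>\<^bsub>N\<^esub> y) \<oplus>\<^bsub>N\<^esub> z = x \<oplus>\<^bsub>N\<^esub> (y \<oplus>\<^bsub>N\<^esub> z)"
        if "x \<in> carrier N" "y \<in> carrier N" "z \<in> carrier N" for x y z
        using that by (auto simp: surj h M.M.a_assoc)
      show "x \<oplus>\<^bsub>N\<^esub> y = y \<oplus>\<^bsub>N\<^esub> x" if "x \<in> carrier N" "y \<in> carrier N" for x y
        using that by (auto simp: surj h M.M.a_comm)
      show "\<zero>\<^bsub>N\<^esub> \<oplus>\<^bsub>N\<^esub> x = x" if "x \<in> carrier N" for x
        using that by (auto simp: surj h zero[symmetric])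
      show "\<exists>y\<in>carrier N. y \<oplus>\<^bsub>N\<^esub> x = \<zero>\<^bsub>N\<^esub>" if x: "x \<in> carrier N" for x
      proof -
        obtain m where m: "m \<in> carrier M" "x = h m" using x by (auto simp: surj)
        show ?thesis
          by (rule bexI[of _ "h (\<ominus>\<^bsub>M\<^esub> m)"])
            (use m in \<open>auto simp: surj h zero[symmetric] M.M.l_neg\<close>)
      qed
    qed
  qed (auto simp: surj h M.smult_l_distr M.smult_r_distr M.smult_assoc1)
qed

lemma submodule_kernel:
  assumes "module R M" "module R N" and h: "h \<in> module_hom R M N"
  shows "submodule {x \<in> carrier M. h x = \<zero>\<^bsub>N\<^esub>} R M"
proof -
  interpret M: module R M by fact
  interpret N: module R N by fact
  interpret h: abelian_group_hom M N h by (rule module_hom_group_hom) fact+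
  show ?thesis
    by (rule M.submoduleI) (auto simp: module_homD(3)[OF h])
qed

lemma submodule_image:
  assumes "module R M" "module R N" and h: "h \<in> module_hom R M N"
  shows "submodule (h ` carrier M) R N"
proof -
  interpret M: module R M by fact
  interpret N: module R N by fact
  interpret h: abelian_group_hom M N h by (rule module_hom_group_hom) fact+
  show ?thesis
    by (rule N.submoduleI)
      (auto simp: module_homD(1)[OF h] module_homD(2,3)[OF h, symmetric] h.hom_zero[symmetric] h.hom_a_inv[symmetric]
        simp del: h.hom_a_inv h.hom_zero h.hom_add h.zero_closed)
qed

subsection \<open>Free modules\<close>

lemma free_module_simps:
  "carrier (free_module R B) =
    {f. (\<forall>b. f b \<in> carrier R) \<and> (\<forall>b. b \<notin> B \<longrightarrow> f b = \<zero>\<^bsub>R\<^esub>) \<and> finite {b. f b \<noteq> \<zero>\<^bsub>R\<^esub>}}"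
  "zero (free_module R B) = (\<lambda>b. \<zero>\<^bsub>R\<^esub>)"
  "add (free_module R B) = (\<lambda>f g b. f b \<oplus>\<^bsub>R\<^esub> g b)"
  "smult (free_module R B) = (\<lambda>a f b. a \<otimes>\<^bsub>R\<^esub> f b)"
  by (simp_all add: free_module_def)

lemma module_free_module:
  fixes R :: "('r, 'm) ring_scheme" and B :: "'b set"
  assumes "cring R"
  shows "module R (free_module R B)"
proof -
  interpret cring R by fact
  have fin: "finite {b. f b \<oplus>\<^bsub>R\<^esub> g b \<noteq> \<zero>\<^bsub>R\<^esub>}"
    if "finite {b. f b \<noteq> \<zero>\<^bsub>R\<^esub>}" "finite {b. g b \<noteq> \<zero>\<^bsub>R\<^esub>}" for f g :: "'b \<Rightarrow> 'r"
    by (rule finite_subset[of _ "{b. f b \<noteq> \<zero>\<^bsub>R\<^esub>} \<union> {b. g b \<noteq> \<zero>\<^bsub>R\<^esub>}"]) (use that in auto)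
  have fin': "finite {b. a \<otimes>\<^bsub>R\<^esub> f b \<noteq> \<zero>\<^bsub>R\<^esub>}"
    if "finite {b. f b \<noteq> \<zero>\<^bsub>R\<^esub>}" "a \<in> carrier R" for a and f :: "'b \<Rightarrow> 'r"
    by (rule finite_subset[of _ "{b. f b \<noteq> \<zero>\<^bsub>R\<^esub>}"]) (use that in auto)
  show ?thesis
  proof (rule moduleI)
    show "abelian_group (free_module R B)"
    proof (rule abelian_groupI)
      show "\<exists>y\<in>carrier (free_module R B). y \<oplus>\<^bsub>free_module R B\<^esub> x = \<zero>\<^bsub>free_module R B\<^esub>"
        if x: "x \<in> carrier (free_module R B)" for x
      proof (rule bexI[of _ "\<lambda>b. \<ominus>\<^bsub>R\<^esub> x b"])
        have "finite {b. \<ominus>\<^bsub>R\<^esub> x b \<noteq> \<zero>\<^bsub>R\<^esub>}"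
          by (rule finite_subset[of _ "{b. x b \<noteq> \<zero>\<^bsub>R\<^esub>}"])
            (use x in \<open>auto simp: free_module_simps\<close>)
        then show "(\<lambda>b. \<ominus>\<^bsub>R\<^esub> x b) \<in> carrier (free_module R B)"
          using x by (auto simp: free_module_simps)
      qed (use x in \<open>auto simp: free_module_simps l_neg\<close>)
    qed (auto simp: free_module_simps fun_eq_iff a_ac fin)
  qed (auto simp: free_module_simps fun_eq_iff l_distr r_distr m_assoc is_cring fin')
qed

lemma basis_elt_closed:
  assumes "cring R" "b \<in> B"
  shows "basis_elt R b \<in> carrier (free_module R B)"
proof -
  interpret cring R by fact
  show ?thesis
    using assms(2) by (auto simp: free_module_simps basis_elt_def)
qed

text \<open>Induction on the support: setting one nonzero value of f to zero leaves a function of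
  strictly smaller support, which differs from f by a multiple of one basis element.\<close>

lemma free_module_induct [consumes 2, case_names zero add]:
  assumes "cring R" and f: "f \<in> carrier (free_module R B)"
    and zero: "P \<zero>\<^bsub>free_module R B\<^esub>"
    and add: "\<And>a b f. \<lbrakk>a \<in> carrier R; b \<in> B; f \<in> carrier (free_module R B); P f\<rbrakk> \<Longrightarrow>
      P (a \<odot>\<^bsub>free_module R B\<^esub> basis_elt R b \<oplus>\<^bsub>free_module R B\<^esub> f)"
  shows "P f"
proof -
  interpret cring R by fact
  have "finite {b. f b \<noteq> \<zero>\<^bsub>R\<^esub>}" using f by (simp add: free_module_simps)
  then show ?thesis using f
  proof (induction "{b. f b \<noteq> \<zero>\<^bsub>R\<^esub>}" arbitrary: f rule: finite_psubset_induct)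
    case psubset
    show ?case
    proof (cases "{b. f b \<noteq> \<zero>\<^bsub>R\<^esub>} = {}")
      case True
      then have "f = \<zero>\<^bsub>free_module R B\<^esub>" by (auto simp: free_module_simps)
      then show ?thesis using zero by simp
    next
      case False
      then obtain b where b: "f b \<noteq> \<zero>\<^bsub>R\<^esub>" by auto
      define g where "g = f(b := \<zero>\<^bsub>R\<^esub>)"
      have sub: "{b. g b \<noteq> \<zero>\<^bsub>R\<^esub>} \<subset> {b. f b \<noteq> \<zero>\<^bsub>R\<^esub>}" using b by (auto simp: g_def)
      then have g: "g \<in> carrier (free_module R B)"
        using psubset finite_subset[of "{b. g b \<noteq> \<zero>\<^bsub>R\<^esub>}" "{b. f b \<noteq> \<zero>\<^bsub>R\<^esub>}"]
        by (auto simp: free_module_simps g_def)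
      have "f = f b \<odot>\<^bsub>free_module R B\<^esub> basis_elt R b \<oplus>\<^bsub>free_module R B\<^esub> g"
        using psubset.prems by (auto simp: free_module_simps g_def basis_elt_def)
      moreover have "f b \<in> carrier R" "b \<in> B"
        using psubset.prems b by (auto simp: free_module_simps)
      ultimately show ?thesis using add psubset.hyps(2)[OF sub g] g by metis
    qed
  qed
qed

lemma module_hom_eq_on_basis:
  assumes "cring R" "module R M"
    and h: "h \<in> module_hom R (free_module R B) M" and k: "k \<in> module_hom R (free_module R B) M"
    and eq: "\<And>b. b \<in> B \<Longrightarrow> h (basis_elt R b) = k (basis_elt R b)"
    and f: "f \<in> carrier (free_module R B)"
  shows "h f = k f"
proof -
  interpret F: module R "free_module R B" by (rule module_free_module) fact
  show ?thesis using \<open>cring R\<close> f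
  proof (induction rule: free_module_induct)
    case zero
    then show ?case
      by (simp add: module_hom_zero[OF F.module_axioms assms(2) h]
          module_hom_zero[OF F.module_axioms assms(2) k])
  next
    case (add a b f)
    then show ?case
      by (simp add: module_homD[OF h] module_homD[OF k] basis_elt_closed \<open>cring R\<close> eq)
  qed
qed

text \<open>Summing over the support gives the shape of the sum in \<open>boundary\<close>, which
  thereby becomes a linear extension by mere unfolding.\<close>

definition lin_ext ::
  "('r, 'm) ring_scheme \<Rightarrow> ('r, 'c, 'k) module_scheme \<Rightarrow> ('b \<Rightarrow> 'c) \<Rightarrow> ('b \<Rightarrow> 'r) \<Rightarrow> 'c" where
  "lin_ext R M \<phi> f = (\<Oplus>\<^bsub>M\<^esub>b\<in>{b. f b \<noteq> \<zero>\<^bsub>R\<^esub>}. f b \<odot>\<^bsub>M\<^esub> \<phi> b)"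

text \<open>The index set of the sum depends on f. A common finite index set is what makes the
  values at different functions comparable; the extra terms have coefficient zero.\<close>

lemma lin_ext_superset:
  assumes "module R M" "f \<in> carrier (free_module R B)" "\<phi> \<in> B \<rightarrow> carrier M"
    and "finite S" "{b. f b \<noteq> \<zero>\<^bsub>R\<^esub>} \<subseteq> S" "S \<subseteq> B"
  shows "lin_ext R M \<phi> f = (\<Oplus>\<^bsub>M\<^esub>b\<in>S. f b \<odot>\<^bsub>M\<^esub> \<phi> b)"
proof -
  interpret module R M by fact
  show ?thesis unfolding lin_ext_def
    by (rule M.add.finprod_mono_neutral_cong_left)
      (use assms in \<open>auto simp: free_module_simps Pi_iff subset_iff\<close>)
qed

lemma lin_ext_basis_elt:
  assumes "module R M" "b \<in> B" "\<phi> \<in> B \<rightarrow> carrier M"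
  shows "lin_ext R M \<phi> (basis_elt R b) = \<phi> b"
proof -
  interpret module R M by fact
  have "lin_ext R M \<phi> (basis_elt R b) = (\<Oplus>\<^bsub>M\<^esub>b'\<in>{b}. basis_elt R b b' \<odot>\<^bsub>M\<^esub> \<phi> b')"
    by (rule lin_ext_superset[where B = B])
      (use assms basis_elt_closed[OF R.is_cring] in \<open>auto simp: basis_elt_def\<close>)
  also have "\<dots> = basis_elt R b b \<odot>\<^bsub>M\<^esub> \<phi> b"
    using assms by (subst M.finsum_insert) (auto simp: basis_elt_def Pi_iff)
  also have "\<dots> = \<phi> b"
    using assms by (simp add: basis_elt_def Pi_iff)
  finally show ?thesis .
qed

lemma lin_ext_hom:
  fixes R :: "('r, 'm) ring_scheme" and B :: "'b set"
  assumes "module R M" "\<phi> \<in> B \<rightarrow> carrier M"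
  shows "lin_ext R M \<phi> \<in> module_hom R (free_module R B) M"
proof -
  interpret module R M by fact
  interpret F: module R "free_module R B" by (rule module_free_module) (rule R.is_cring)
  define supp where "supp f = {b. f b \<noteq> \<zero>\<^bsub>R\<^esub>}" for f :: "'b \<Rightarrow> 'r"
  have supp: "finite (supp f)" "supp f \<subseteq> B" "\<And>b. f b \<in> carrier R"
    if "f \<in> carrier (free_module R B)" for f
    using that by (auto simp: free_module_simps supp_def)
  show ?thesis
  proof (rule module_homI)
    fix f assume f: "f \<in> carrier (free_module R B)"
    show "lin_ext R M \<phi> f \<in> carrier M" unfolding lin_ext_def
      by (rule M.finsum_closed) (use f assms in \<open>auto simp: free_module_simps Pi_iff\<close>)
  next
    fix f g assume f: "f \<in> carrier (free_module R B)" and g: "g \<in> carrier (free_module R B)"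
    \<comment> \<open>Cancellation may make the support of the sum smaller than this union, hence
      the passage to a superset.\<close>
    let ?S = "supp f \<union> supp g"
    have "lin_ext R M \<phi> (f \<oplus>\<^bsub>free_module R B\<^esub> g) =
        (\<Oplus>\<^bsub>M\<^esub>b\<in>?S. (f \<oplus>\<^bsub>free_module R B\<^esub> g) b \<odot>\<^bsub>M\<^esub> \<phi> b)"
      by (rule lin_ext_superset[where B = B])
        (use assms f g supp[OF f] supp[OF g] F.M.a_closed[OF f g] in \<open>auto simp: supp_def free_module_simps(3)\<close>)
    also have "\<dots> = (\<Oplus>\<^bsub>M\<^esub>b\<in>?S. f b \<odot>\<^bsub>M\<^esub> \<phi> b \<oplus>\<^bsub>M\<^esub> g b \<odot>\<^bsub>M\<^esub> \<phi> b)"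
      by (rule M.finsum_cong')
        (use assms f g supp[OF f] supp[OF g] in \<open>auto simp: free_module_simps(3) smult_l_distr Pi_iff\<close>)
    also have "\<dots> = (\<Oplus>\<^bsub>M\<^esub>b\<in>?S. f b \<odot>\<^bsub>M\<^esub> \<phi> b) \<oplus>\<^bsub>M\<^esub> (\<Oplus>\<^bsub>M\<^esub>b\<in>?S. g b \<odot>\<^bsub>M\<^esub> \<phi> b)"
      by (rule M.finsum_addf) (use assms supp[OF f] supp[OF g] in \<open>auto simp: Pi_iff\<close>)
    also have "(\<Oplus>\<^bsub>M\<^esub>b\<in>?S. f b \<odot>\<^bsub>M\<^esub> \<phi> b) = lin_ext R M \<phi> f"
      by (rule lin_ext_superset[where B = B, symmetric])
        (use assms f supp[OF f] supp[OF g] in \<open>auto simp: supp_def\<close>)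
    also have "(\<Oplus>\<^bsub>M\<^esub>b\<in>?S. g b \<odot>\<^bsub>M\<^esub> \<phi> b) = lin_ext R M \<phi> g"
      by (rule lin_ext_superset[where B = B, symmetric])
        (use assms g supp[OF f] supp[OF g] in \<open>auto simp: supp_def\<close>)
    finally show "lin_ext R M \<phi> (f \<oplus>\<^bsub>free_module R B\<^esub> g) = lin_ext R M \<phi> f \<oplus>\<^bsub>M\<^esub> lin_ext R M \<phi> g" .
  next
    fix a f assume a: "a \<in> carrier R" and f: "f \<in> carrier (free_module R B)"
    have "lin_ext R M \<phi> (a \<odot>\<^bsub>free_module R B\<^esub> f) =
        (\<Oplus>\<^bsub>M\<^esub>b\<in>supp f. (a \<odot>\<^bsub>free_module R B\<^esub> f) b \<odot>\<^bsub>M\<^esub> \<phi> b)"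
      by (rule lin_ext_superset[where B = B])
        (use assms a f supp[OF f] F.smult_closed[OF a f] in \<open>auto simp: supp_def free_module_simps(4)\<close>)
    also have "\<dots> = (\<Oplus>\<^bsub>M\<^esub>b\<in>supp f. a \<odot>\<^bsub>M\<^esub> (f b \<odot>\<^bsub>M\<^esub> \<phi> b))"
      by (rule M.finsum_cong')
        (use assms a f supp[OF f] in \<open>auto simp: free_module_simps(4) smult_assoc1 Pi_iff\<close>)
    also have "\<dots> = a \<odot>\<^bsub>M\<^esub> lin_ext R M \<phi> f"
      unfolding lin_ext_def supp_def[symmetric]
      by (rule finsum_smult_ldistr[symmetric]) (use assms a supp[OF f] in \<open>auto simp: Pi_iff\<close>)
    finally show "lin_ext R M \<phi> (a \<odot>\<^bsub>free_module R B\<^esub> f) = a \<odot>\<^bsub>M\<^esub> lin_ext R M \<phi> f" .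
  qed
qed

text \<open>Here f is fixed and the values on the basis vary linearly with x. The support is then
  fixed too, and the sums are compared term by term. This is the source of linearity in the second
  factor of a concatenation.\<close>

lemma lin_ext_hom_param:
  assumes "module R M" and f: "f \<in> carrier (free_module R B)"
    and \<phi>: "\<And>b. b \<in> B \<Longrightarrow> \<phi> b \<in> module_hom R N M"
  shows "(\<lambda>x. lin_ext R M (\<lambda>b. \<phi> b x) f) \<in> module_hom R N M"
proof -
  interpret module R M by fact
  note \<phi> = module_homD[OF \<phi>]
  have f: "finite {b. f b \<noteq> \<zero>\<^bsub>R\<^esub>}" "\<And>b. f b \<noteq> \<zero>\<^bsub>R\<^esub> \<Longrightarrow> b \<in> B" "\<And>b. f b \<in> carrier R"
    using f by (auto simp: free_module_simps)
  show ?thesis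
  proof (rule module_homI)
    show "lin_ext R M (\<lambda>b. \<phi> b x) f \<in> carrier M" if "x \<in> carrier N" for x
      unfolding lin_ext_def by (rule M.finsum_closed) (use f \<phi> that in auto)
  next
    fix x y assume xy: "x \<in> carrier N" "y \<in> carrier N"
    show "lin_ext R M (\<lambda>b. \<phi> b (x \<oplus>\<^bsub>N\<^esub> y)) f =
        lin_ext R M (\<lambda>b. \<phi> b x) f \<oplus>\<^bsub>M\<^esub> lin_ext R M (\<lambda>b. \<phi> b y) f"
      unfolding lin_ext_def
      by (rule trans[OF M.finsum_cong' M.finsum_addf])
        (use f \<phi> xy in \<open>auto simp: smult_r_distr\<close>)
  next
    fix a x assume ax: "a \<in> carrier R" "x \<in> carrier N"
    show "lin_ext R M (\<lambda>b. \<phi> b (a \<odot>\<^bsub>N\<^esub> x)) f = a \<odot>\<^bsub>M\<^esub> lin_ext R M (\<lambda>b. \<phi> b x) f"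
      unfolding lin_ext_def
      by (subst finsum_smult_ldistr)
        (use f \<phi> ax in \<open>auto simp: smult_assoc1[symmetric] R.m_comm intro!: M.finsum_cong'\<close>)
  qed
qed

subsection \<open>Quotients\<close>

text \<open>For homology this turns equality of classes into an explicit boundary accounting for the
  difference, the form in which products of different representatives are compared.\<close>

lemma coset_eq_iff:
  assumes "module R M" "submodule N R M" "x \<in> carrier M" "y \<in> carrier M"
  shows "N +>\<^bsub>M\<^esub> x = N +>\<^bsub>M\<^esub> y \<longleftrightarrow> (\<exists>n\<in>N. y = n \<oplus>\<^bsub>M\<^esub> x)"
proof -
  interpret module R M by fact
  interpret N: submodule N R M by fact
  have sub: "n \<in> N \<Longrightarrow> n \<in> carrier M" for n using N.subset by auto
  note zero = N.one_closed[simplified] and add = N.m_closed[simplified]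
  show ?thesis
  proof
    assume eq: "N +>\<^bsub>M\<^esub> x = N +>\<^bsub>M\<^esub> y"
    have "y = \<zero>\<^bsub>M\<^esub> \<oplus>\<^bsub>M\<^esub> y" using assms by simp
    then have "y \<in> N +>\<^bsub>M\<^esub> y" using zero unfolding a_r_coset_def' by blast
    then show "\<exists>n\<in>N. y = n \<oplus>\<^bsub>M\<^esub> x" unfolding eq[symmetric] by (auto simp: a_r_coset_def')
  next
    assume "\<exists>n\<in>N. y = n \<oplus>\<^bsub>M\<^esub> x"
    then obtain n where n: "n \<in> N" "y = n \<oplus>\<^bsub>M\<^esub> x" by auto
    have inv: "\<ominus>\<^bsub>M\<^esub> n \<in> N" using module.submoduleE(3)[OF assms(1,2) n(1)] .
    show "N +>\<^bsub>M\<^esub> x = N +>\<^bsub>M\<^esub> y"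
    proof (intro equalityI subsetI)
      fix z assume "z \<in> N +>\<^bsub>M\<^esub> x"
      then obtain m where m: "m \<in> N" "z = m \<oplus>\<^bsub>M\<^esub> x" by (auto simp: a_r_coset_def')
      then have "z = (m \<oplus>\<^bsub>M\<^esub> (\<ominus>\<^bsub>M\<^esub> n)) \<oplus>\<^bsub>M\<^esub> y"
        using n assms sub inv by (simp add: M.a_assoc M.r_neg1)
      then show "z \<in> N +>\<^bsub>M\<^esub> y" using add[OF m(1) inv] by (auto simp: a_r_coset_def')
    next
      fix z assume "z \<in> N +>\<^bsub>M\<^esub> y"
      then obtain m where m: "m \<in> N" "z = m \<oplus>\<^bsub>M\<^esub> y" by (auto simp: a_r_coset_def')
      then have "z = (m \<oplus>\<^bsub>M\<^esub> n) \<oplus>\<^bsub>M\<^esub> x"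
        using n assms sub by (simp add: M.a_assoc)
      then show "z \<in> N +>\<^bsub>M\<^esub> x" using add[OF m(1) n(1)] by (auto simp: a_r_coset_def')
    qed
  qed
qed

lemma coset_zero:
  assumes "module R M" "submodule N R M"
  shows "N +>\<^bsub>M\<^esub> \<zero>\<^bsub>M\<^esub> = N"
proof -
  interpret module R M by fact
  interpret N: submodule N R M by fact
  have sub: "n \<in> N \<Longrightarrow> n \<in> carrier M" for n using N.subset by auto
  show ?thesis by (auto simp: a_r_coset_def' sub intro: bexI)
qed

text \<open>Homology is the image of the cycles \<open>Z\<close> in the quotient of the chains by the boundaries \<open>N\<close>; seen
  in this way, its module structure does not depend on \<open>\<partial>\<^sup>2 = 0\<close>.\<close>

lemma quotient_map_hom:
  fixes R :: "('r, 'm) ring_scheme" and M :: "('r, 'b, 'n) module_scheme"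
  assumes "module R M" "submodule N R M" "Z \<subseteq> carrier M"
  shows "(\<lambda>x. N +>\<^bsub>M\<^esub> x) \<in> module_hom R (M\<lparr>carrier := Z\<rparr>) (quotient_module (M\<lparr>carrier := Z\<rparr>) N)"
    and "carrier (quotient_module (M\<lparr>carrier := Z\<rparr>) N) = (\<lambda>x. N +>\<^bsub>M\<^esub> x) ` Z"
proof -
  interpret module R M by fact
  interpret N: submodule N R M by fact
  have sub: "n \<in> N \<Longrightarrow> n \<in> carrier M" for n using N.subset by auto
  have Z: "x \<in> Z \<Longrightarrow> x \<in> carrier M" for x using assms by auto
  note zero = N.one_closed[simplified] and add = N.m_closed[simplified]
  \<comment> \<open>Cosets involve only the addition, so replacing the carrier does not affect
    them.\<close>
  have coset: "N +>\<^bsub>M\<lparr>carrier := Z\<rparr>\<^esub> x = N +>\<^bsub>M\<^esub> x" for x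
    by (simp add: a_r_coset_def')
  show car: "carrier (quotient_module (M\<lparr>carrier := Z\<rparr>) N) = (\<lambda>x. N +>\<^bsub>M\<^esub> x) ` Z"
    using coset by (auto simp: quotient_module_def A_RCOSETS_def')
  have sum: "set_add (M\<lparr>carrier := Z\<rparr>) (N +>\<^bsub>M\<^esub> x) (N +>\<^bsub>M\<^esub> y) = N +>\<^bsub>M\<^esub> (x \<oplus>\<^bsub>M\<^esub> y)"
    if xy: "x \<in> carrier M" "y \<in> carrier M" for x y
  proof -
    have *: "m \<oplus>\<^bsub>M\<^esub> x \<oplus>\<^bsub>M\<^esub> (n \<oplus>\<^bsub>M\<^esub> y) = (m \<oplus>\<^bsub>M\<^esub> n) \<oplus>\<^bsub>M\<^esub> (x \<oplus>\<^bsub>M\<^esub> y)"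
      if "m \<in> N" "n \<in> N" for m n
      using that xy sub by (simp add: M.a_ac)
    \<comment> \<open>The zero of N serves as the contribution of the second coset, so every element
      of the coset of the sum is a sum of elements of the two cosets.\<close>
    have **: "m \<oplus>\<^bsub>M\<^esub> (x \<oplus>\<^bsub>M\<^esub> y) = m \<oplus>\<^bsub>M\<^esub> x \<oplus>\<^bsub>M\<^esub> (\<zero>\<^bsub>M\<^esub> \<oplus>\<^bsub>M\<^esub> y)" if "m \<in> N" for m
      using that xy sub by (simp add: M.a_assoc)
    show ?thesis
    proof (intro equalityI subsetI)
      fix z assume "z \<in> set_add (M\<lparr>carrier := Z\<rparr>) (N +>\<^bsub>M\<^esub> x) (N +>\<^bsub>M\<^esub> y)"
      then show "z \<in> N +>\<^bsub>M\<^esub> (x \<oplus>\<^bsub>M\<^esub> y)"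
        by (auto simp: set_add_def' a_r_coset_def' * intro: add)
    next
      fix z assume "z \<in> N +>\<^bsub>M\<^esub> (x \<oplus>\<^bsub>M\<^esub> y)"
      then obtain m where "m \<in> N" "z = m \<oplus>\<^bsub>M\<^esub> x \<oplus>\<^bsub>M\<^esub> (\<zero>\<^bsub>M\<^esub> \<oplus>\<^bsub>M\<^esub> y)"
        using ** by (auto simp: a_r_coset_def')
      then show "z \<in> set_add (M\<lparr>carrier := Z\<rparr>) (N +>\<^bsub>M\<^esub> x) (N +>\<^bsub>M\<^esub> y)"
        using zero unfolding set_add_def' a_r_coset_def' by auto
    qed
  qed
  \<comment> \<open>The quotient scales a coset by a union over all its representatives. Since N is
    closed under scalars, all cosets in this union coincide.\<close>
  have smult: "(\<Union>x\<in>N +>\<^bsub>M\<^esub> x. N +>\<^bsub>M\<^esub> (a \<odot>\<^bsub>M\<^esub> x)) = N +>\<^bsub>M\<^esub> (a \<odot>\<^bsub>M\<^esub> x)"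
    if ax: "a \<in> carrier R" "x \<in> carrier M" for a x
  proof -
    have *: "N +>\<^bsub>M\<^esub> (a \<odot>\<^bsub>M\<^esub> y) = N +>\<^bsub>M\<^esub> (a \<odot>\<^bsub>M\<^esub> x)" if "y \<in> N +>\<^bsub>M\<^esub> x" for y
    proof -
      obtain n where n: "n \<in> N" "y = n \<oplus>\<^bsub>M\<^esub> x" using \<open>y \<in> N +>\<^bsub>M\<^esub> x\<close> by (auto simp: a_r_coset_def')
      then have "a \<odot>\<^bsub>M\<^esub> y = a \<odot>\<^bsub>M\<^esub> n \<oplus>\<^bsub>M\<^esub> a \<odot>\<^bsub>M\<^esub> x" using ax sub by (simp add: smult_r_distr)
      moreover have "a \<odot>\<^bsub>M\<^esub> n \<in> N" using ax n N.smult_closed by auto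
      ultimately show ?thesis
        using coset_eq_iff[OF assms(1,2), of "a \<odot>\<^bsub>M\<^esub> x" "a \<odot>\<^bsub>M\<^esub> y"] ax n sub by auto
    qed
    \<comment> \<open>A union of equal sets is their common value only if the index set is
      nonempty.\<close>
    have "x \<in> N +>\<^bsub>M\<^esub> x" using zero M.l_zero[OF ax(2)] unfolding a_r_coset_def' by force
    then show ?thesis by (intro SUP_eq_const *) auto
  qed
  show "(\<lambda>x. N +>\<^bsub>M\<^esub> x) \<in> module_hom R (M\<lparr>carrier := Z\<rparr>) (quotient_module (M\<lparr>carrier := Z\<rparr>) N)"
  proof (rule module_homI)
    show "N +>\<^bsub>M\<^esub> x \<in> carrier (quotient_module (M\<lparr>carrier := Z\<rparr>) N)"
      if "x \<in> carrier (M\<lparr>carrier := Z\<rparr>)" for x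
      using that by (auto simp: car)
  qed (auto simp: quotient_module_def coset sum smult Z)
qed

text \<open>The coset map from Z is onto by construction, so \<open>module_surj_image\<close>
  transports the axioms; its condition on zero is \<open>coset_zero\<close>.\<close>

lemma module_quotient_module:
  assumes "module R M" "submodule N R M" "submodule Z R M"
  shows "module R (quotient_module (M\<lparr>carrier := Z\<rparr>) N)"
proof -
  have sub: "Z \<subseteq> carrier M" using module.submoduleE(1)[OF assms(1,3)] .
  show ?thesis
  proof (rule module_surj_image)
    show "module R (M\<lparr>carrier := Z\<rparr>)"
      by (rule submodule.submodule_is_module[OF assms(3,1)])
    show "N +>\<^bsub>M\<^esub> \<zero>\<^bsub>M\<lparr>carrier := Z\<rparr>\<^esub> = \<zero>\<^bsub>quotient_module (M\<lparr>carrier := Z\<rparr>) N\<^esub>"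
      using coset_zero[OF assms(1,2)] by (simp add: quotient_module_def)
  qed (use quotient_map_hom[OF assms(1,2) sub] in simp_all)
qed

subsection \<open>Tensor products\<close>

lemma submodule_generated:
  assumes "module R M" "S \<subseteq> carrier M"
  shows "submodule (submodule_generated R M S) R M"
proof -
  interpret module R M by fact
  \<comment> \<open>The carrier belongs to the intersected family, so the intersection does not
    leave it.\<close>
  have "submodule (carrier M) R M" by (rule carrier_is_submodule)
  with assms(2) have sub: "submodule_generated R M S \<subseteq> carrier M"
    by (auto simp: submodule_generated_def)
  have "\<zero>\<^bsub>M\<^esub> \<in> H" if "submodule H R M" for H
    using subgroup.one_closed[OF submodule.axioms(1)[OF that]] by simp
  with sub show ?thesis
    by (intro submoduleI) (auto simp: submodule_generated_def intro: submoduleE)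
qed

lemma tensor_relations_closed:
  assumes "module R M" "module R N"
  shows "tensor_relations R M N \<subseteq> carrier (free_module R (carrier M \<times> carrier N))"
proof -
  interpret M: module R M by fact
  interpret N: module R N by fact
  interpret F: module R "free_module R (carrier M \<times> carrier N)"
    by (rule module_free_module) (rule M.R.is_cring)
  have "basis_elt R (x, y) \<in> carrier (free_module R (carrier M \<times> carrier N))"
    if "x \<in> carrier M" "y \<in> carrier N" for x y
    using that by (intro basis_elt_closed M.R.is_cring) auto
  then show ?thesis
    by (auto simp: tensor_relations_def Let_def intro!: F.M.minus_closed)
qed

text \<open>The linear extension of the bilinear map to the free module on pairs kills the tensor
  relations, hence descends to the quotient. It is unique because pure tensors are the images of the
  basis, and extensionality fixes the values outside the carrier.\<close>

lemma tensor_product_universal: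
  fixes R :: "('r, 'm) ring_scheme" and M :: "('r, 'b, 'n) module_scheme"
    and N :: "('r, 'c, 'k) module_scheme" and P :: "('r, 'd, 'l) module_scheme"
  assumes "module R M" "module R N" "module R P"
    and bil1: "\<And>y. y \<in> carrier N \<Longrightarrow> (\<lambda>x. \<beta> x y) \<in> module_hom R M P"
    and bil2: "\<And>x. x \<in> carrier M \<Longrightarrow> \<beta> x \<in> module_hom R N P"
  shows "\<exists>!\<Phi>. \<Phi> \<in> linear_maps R (tensor_product R M N) P \<and>
    (\<forall>x\<in>carrier M. \<forall>y\<in>carrier N. \<Phi> (pure_tensor R M N x y) = \<beta> x y)"
proof -
  interpret M: module R M by fact
  interpret N: module R N by fact
  interpret P: module R P by fact
  note cring = M.R.is_cring
  let ?F = "free_module R (carrier M \<times> carrier N)" and ?K = "tensor_kernel R M N"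
  interpret F: module R ?F by (rule module_free_module) (rule cring)
  have K: "submodule ?K R ?F"
    unfolding tensor_kernel_def
    by (rule submodule_generated[OF F.module_axioms tensor_relations_closed[OF assms(1,2)]])
  define \<pi> where "\<pi> = (\<lambda>f. ?K +>\<^bsub>?F\<^esub> f)"
  \<comment> \<open>\<open>quotient_map_hom\<close> speaks of a module with replaced carrier;
    replacing the carrier by itself makes it applicable.\<close>
  have T: "tensor_product R M N = quotient_module (?F\<lparr>carrier := carrier ?F\<rparr>) ?K"
    by (simp add: tensor_product_def)
  have \<pi>: "\<pi> \<in> module_hom R ?F (tensor_product R M N)"
    unfolding \<pi>_def
    using quotient_map_hom(1)[OF F.module_axioms K subset_refl] by (simp add: tensor_product_def)
  have surj: "carrier (tensor_product R M N) = \<pi> ` carrier ?F"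
    unfolding T \<pi>_def by (rule quotient_map_hom(2)[OF F.module_axioms K subset_refl])
  have pure: "pure_tensor R M N x y = \<pi> (basis_elt R (x, y))" for x y
    by (simp add: pure_tensor_def \<pi>_def)
  define h where "h = lin_ext R P (\<lambda>(x, y). \<beta> x y)"
  have \<beta>: "(\<lambda>(x, y). \<beta> x y) \<in> carrier M \<times> carrier N \<rightarrow> carrier P"
    using module_homD(1)[OF bil2] by auto
  have h: "h \<in> module_hom R ?F P"
    unfolding h_def by (rule lin_ext_hom[OF assms(3) \<beta>])
  have h_basis: "h (basis_elt R (x, y)) = \<beta> x y" if "x \<in> carrier M" "y \<in> carrier N" for x y
    unfolding h_def using lin_ext_basis_elt[OF assms(3) _ \<beta>, of "(x, y)"] that by auto
  interpret h: abelian_group_hom ?F P h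
    by (rule module_hom_group_hom[OF F.module_axioms assms(3) h])
  have e: "basis_elt R (x, y) \<in> carrier ?F" if "x \<in> carrier M" "y \<in> carrier N" for x y
    using that by (intro basis_elt_closed cring) auto
  have "tensor_relations R M N \<subseteq> {f \<in> carrier ?F. h f = \<zero>\<^bsub>P\<^esub>}"
  proof -
    have "h f = \<zero>\<^bsub>P\<^esub>" if "f \<in> tensor_relations R M N" for f
      using that
      by (auto simp: tensor_relations_def Let_def e h_basis module_homD[OF h] a_minus_def
          module_homD[OF bil1] module_homD[OF bil2] P.M.r_neg)
    then show ?thesis using tensor_relations_closed[OF assms(1,2)] by auto
  qed
  \<comment> \<open>The kernel of h is a submodule containing the relations, hence a member of the
    family whose intersection is the tensor kernel.\<close>
  then have K_sub: "?K \<subseteq> {f \<in> carrier ?F. h f = \<zero>\<^bsub>P\<^esub>}"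
    using submodule_kernel[OF F.module_axioms assms(3) h]
    unfolding tensor_kernel_def submodule_generated_def by blast
  have h_cong: "h f = h g" if fg: "f \<in> carrier ?F" "g \<in> carrier ?F" "\<pi> f = \<pi> g" for f g
  proof -
    obtain n where "n \<in> ?K" "g = n \<oplus>\<^bsub>?F\<^esub> f"
      using fg coset_eq_iff[OF F.module_axioms K fg(1,2)] by (auto simp: \<pi>_def)
    moreover from this have "n \<in> carrier ?F" "h n = \<zero>\<^bsub>P\<^esub>"
      using K_sub by auto
    ultimately show ?thesis using fg by simp
  qed
  \<comment> \<open>Each coset receives the value of h at a chosen representative, which by
    \<open>h_cong\<close> does not depend on the choice; \<open>restrict\<close> supplies the
    extensionality demanded by \<open>linear_maps\<close>.\<close>
  define \<Phi> where "\<Phi> = restrict (\<lambda>t. h (SOME f. f \<in> carrier ?F \<and> \<pi> f = t)) (carrier (tensor_product R M N))"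
  have \<Phi>: "\<Phi> (\<pi> f) = h f" if f: "f \<in> carrier ?F" for f
  proof -
    have "(SOME g. g \<in> carrier ?F \<and> \<pi> g = \<pi> f) \<in> carrier ?F \<and>
        \<pi> (SOME g. g \<in> carrier ?F \<and> \<pi> g = \<pi> f) = \<pi> f"
      by (rule someI[of _ f]) (use f in simp)
    then have "h (SOME g. g \<in> carrier ?F \<and> \<pi> g = \<pi> f) = h f"
      using f by (intro h_cong) blast+
    then show ?thesis using f by (simp add: \<Phi>_def surj)
  qed
  show ?thesis
  proof (rule ex1I[of _ \<Phi>], intro conjI ballI)
    show "\<Phi> \<in> linear_maps R (tensor_product R M N) P"
      unfolding linear_maps_def
    proof (intro CollectI conjI ballI)
      show "\<Phi> \<in> carrier (tensor_product R M N) \<rightarrow>\<^sub>E carrier P"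
        using \<Phi> by (auto simp: surj \<Phi>_def simp del: restrict_apply')
    qed (auto simp: surj \<Phi> module_homD[OF h] simp flip: module_homD(2,3)[OF \<pi>])
    show "\<Phi> (pure_tensor R M N x y) = \<beta> x y" if "x \<in> carrier M" "y \<in> carrier N" for x y
      using that by (simp add: pure \<Phi> e h_basis)
  next
    fix \<Psi> assume \<Psi>: "\<Psi> \<in> linear_maps R (tensor_product R M N) P \<and>
      (\<forall>x\<in>carrier M. \<forall>y\<in>carrier N. \<Psi> (pure_tensor R M N x y) = \<beta> x y)"
    then have "\<Psi> \<in> module_hom R (tensor_product R M N) P"
      by (auto simp: linear_maps_def module_hom_def)
    from module_hom_comp[OF \<pi> this]
    have \<Psi>\<pi>: "(\<lambda>f. \<Psi> (\<pi> f)) \<in> module_hom R ?F P" .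
    have "\<Psi> (\<pi> f) = h f" if "f \<in> carrier ?F" for f
      by (rule module_hom_eq_on_basis[OF cring assms(3) \<Psi>\<pi> h _ that])
        (use \<Psi> in \<open>auto simp: h_basis simp flip: pure\<close>)
    then have "\<Psi> t = \<Phi> t" if "t \<in> carrier (tensor_product R M N)" for t
      using that \<Phi> by (auto simp: surj)
    moreover have "\<Psi> t = \<Phi> t" if "t \<notin> carrier (tensor_product R M N)" for t
      using that \<Psi> by (auto simp: \<Phi>_def linear_maps_def PiE_def extensional_def)
    ultimately show "\<Psi> = \<Phi>" by blast
  qed
qed

section \<open>Faces and cube chains\<close>

context precubical_set
begin

text \<open>The recursion of \<open>face_list\<close> peels off the face applied last. Peeling off
  the one applied first, in the full dimension n, is what the inductions on lists below
  need.\<close>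

lemma face_list_snoc:
  "face_list X \<epsilon> n (as @ [a]) x = face_list X \<epsilon> (n - 1) as (face X \<epsilon> n a x)"
  by (induction as) auto

lemma face_list_closed:
  assumes "sorted_wrt (<) as" "set as \<subseteq> {1..n}" "x \<in> cells X n"
  shows "face_list X \<epsilon> n as x \<in> cells X (n - length as)"
  using assms
proof (induction as arbitrary: n x rule: rev_induct)
  case (snoc a as)
  \<comment> \<open>The indices before a are smaller than a, hence still admissible after the
    dimension has dropped by one.\<close>
  have "set as \<subseteq> {1..n - 1}" using snoc.prems by (force simp: sorted_wrt_append)
  then show ?case
    using snoc.prems snoc.IH[of "n - 1" "face X \<epsilon> n a x"] face_closed[of a n x]
    by (auto simp: face_list_snoc sorted_wrt_append)
qed auto

lemma end_vertex_Suc: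
  "end_vertex X \<epsilon> (Suc n, x) = end_vertex X \<epsilon> (n, face X \<epsilon> (Suc n) (Suc n) x)"
proof -
  have "sorted_list_of_set {1..m} = [1..<Suc m]" for m :: nat
    by (metis atLeastLessThanSuc_atLeastAtMost sorted_list_of_set_range)
  then show ?thesis
    by (simp add: end_vertex_def face_set_def face_list_snoc del: face_list.simps)
qed

text \<open>The end vertex is reached by repeatedly taking last faces. The precubical identity lets
  the last face be taken before the face in direction a, and the induction hypothesis then applies
  to the last face of x.\<close>

lemma end_vertex_face:
  assumes "1 \<le> a" "a \<le> n" "x \<in> cells X n"
  shows "end_vertex X \<epsilon> (n - 1, face X \<epsilon> n a x) = end_vertex X \<epsilon> (n, x)"
  using assms
proof (induction n arbitrary: a x)
  case (Suc n)
  show ?case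
  proof (cases "a = Suc n")
    case True
    then show ?thesis by (simp add: end_vertex_Suc)
  next
    case False
    with Suc.prems have a: "1 \<le> a" "a \<le> n" by auto
    then obtain m where m: "n = Suc m" by (cases n) auto
    let ?y = "face X \<epsilon> (Suc n) (Suc n) x"
    have y: "?y \<in> cells X n" using Suc.prems face_closed[of "Suc n" "Suc n" x] by auto
    have "end_vertex X \<epsilon> (n, face X \<epsilon> (Suc n) a x) =
        end_vertex X \<epsilon> (m, face X \<epsilon> n n (face X \<epsilon> (Suc n) a x))"
      by (simp add: m end_vertex_Suc)
    also have "face X \<epsilon> n n (face X \<epsilon> (Suc n) a x) = face X \<epsilon> n a ?y"
      using face_face[of a "Suc n" "Suc n" x \<epsilon> \<epsilon>] a Suc.prems by simp
    also have "end_vertex X \<epsilon> (m, face X \<epsilon> n a ?y) = end_vertex X \<epsilon> (n, ?y)"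
      using Suc.IH[OF a y] by (simp add: m)
    finally show ?thesis by (simp add: end_vertex_Suc)
  qed
qed auto

lemma end_vertex_face_list:
  assumes "sorted_wrt (<) as" "set as \<subseteq> {1..n}" "x \<in> cells X n"
  shows "end_vertex X \<epsilon> (n - length as, face_list X \<epsilon> n as x) = end_vertex X \<epsilon> (n, x)"
  using assms
proof (induction as arbitrary: n x rule: rev_induct)
  case (snoc a as)
  have "set as \<subseteq> {1..n - 1}" using snoc.prems by (force simp: sorted_wrt_append)
  then show ?case
    using snoc.prems snoc.IH[of "n - 1" "face X \<epsilon> n a x"] face_closed[of a n x] end_vertex_face[of a n x]
    by (auto simp: face_list_snoc sorted_wrt_append)
qed auto

text \<open>A last face moves past every face with a smaller index. Its own index drops by one each
  time, and so does the dimension, so it stays the last face.\<close>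

lemma face_list_last_face:
  assumes "sorted_wrt (<) as" "set as \<subseteq> {1..<n}" "x \<in> cells X n"
  shows "face_list X \<epsilon> (n - 1) as (face X \<eta> n n x) =
    face X \<eta> (n - length as) (n - length as) (face_list X \<epsilon> n as x)"
  using assms
proof (induction as arbitrary: n x rule: rev_induct)
  case (snoc a as)
  have sub: "set as \<subseteq> {1..<n - 1}" using snoc.prems by (force simp: sorted_wrt_append)
  have a: "1 \<le> a" "a < n" using snoc.prems by auto
  then have "face X \<epsilon> (n - 1) a (face X \<eta> n n x) = face X \<eta> (n - 1) (n - 1) (face X \<epsilon> n a x)"
    using face_face[of a n n x \<epsilon> \<eta>] snoc.prems by simp
  then show ?case
    using snoc.IH[of "n - 1" "face X \<epsilon> n a x"] sub snoc.prems a face_closed[of a n x \<epsilon>]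
    by (simp add: face_list_snoc sorted_wrt_append)
qed auto

lemma sorted_list_of_set_interval:
  fixes A :: "nat set"
  assumes "A \<subseteq> {1..n}"
  shows "sorted_wrt (<) (sorted_list_of_set A)" "set (sorted_list_of_set A) = A"
    "length (sorted_list_of_set A) = card A"
  using finite_subset[OF assms] by auto

lemma face_set_closed:
  assumes "A \<subseteq> {1..n}" "x \<in> cells X n"
  shows "face_set X \<epsilon> n A x \<in> cells X (n - card A)"
  using face_list_closed[of "sorted_list_of_set A" n x] sorted_list_of_set_interval[OF assms(1)] assms
  by (simp add: face_set_def)

lemma end_vertex_face_set:
  assumes "A \<subseteq> {1..n}" "x \<in> cells X n"
  shows "end_vertex X \<epsilon> (n - card A, face_set X \<epsilon> n A x) = end_vertex X \<epsilon> (n, x)"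
  using end_vertex_face_list[of "sorted_list_of_set A" n x] sorted_list_of_set_interval[OF assms(1)] assms
  by (simp add: face_set_def)

lemma end_vertex_closed:
  assumes "x \<in> cells X n"
  shows "end_vertex X \<epsilon> (n, x) \<in> cells X 0"
  using face_set_closed[of "{1..n}" n x] assms by (simp add: end_vertex_def)

text \<open>The largest index comes last in the sorted list and is therefore applied first.\<close>

lemma face_set_Suc:
  assumes "A \<subseteq> {1..n}"
  shows "face_set X \<epsilon> (Suc n) (insert (Suc n) A) x = face_set X \<epsilon> n A (face X \<epsilon> (Suc n) (Suc n) x)"
proof -
  note A = sorted_list_of_set_interval[OF assms]
  have "sorted_list_of_set (insert (Suc n) A) = sorted_list_of_set A @ [Suc n]"
  proof (rule strict_sorted_equal)
    show "sorted_wrt (<) (sorted_list_of_set A @ [Suc n])"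
      using assms A by (auto simp: sorted_wrt_append)
    show "sorted_wrt (<) (sorted_list_of_set (insert (Suc n) A))"
      by (rule strict_sorted_list_of_set)
    show "set (sorted_list_of_set (insert (Suc n) A)) = set (sorted_list_of_set A @ [Suc n])"
      using finite_subset[OF assms] by (simp del: sorted_list_of_set_insert_remove)
  qed
  then show ?thesis by (simp add: face_set_def face_list_snoc)
qed

lemma face_set_last_face:
  assumes "A \<subseteq> {1..n}" "x \<in> cells X (Suc n)"
  shows "face_set X \<epsilon> n A (face X \<eta> (Suc n) (Suc n) x) =
    face X \<eta> (Suc n - card A) (Suc n - card A) (face_set X \<epsilon> (Suc n) A x)"
  using face_list_last_face[of "sorted_list_of_set A" "Suc n" x] assms
    sorted_list_of_set_interval[OF assms(1)]
  by (simp add: face_set_def atLeastLessThanSuc_atLeastAtMost)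

text \<open>For \<open>\<epsilon> = 0\<close> and \<open>\<eta> = 1\<close>: the two cubes into which a cube is split are composable.\<close>

lemma end_vertex_complementary_faces:
  assumes "A \<union> B = {1..n}" "A \<inter> B = {}" "x \<in> cells X n"
  shows "end_vertex X \<eta> (card B, face_set X \<epsilon> n A x) = end_vertex X \<epsilon> (card A, face_set X \<eta> n B x)"
  using assms
proof (induction n arbitrary: A B \<epsilon> \<eta> x)
  case 0
  then show ?case by (simp add: end_vertex_def face_set_def)
next
  case (Suc n)
  \<comment> \<open>The claim is symmetric under exchanging A with B and the two face types, so the
    last index may be assumed to lie in B.\<close>
  have *: "end_vertex X \<eta> (card B, face_set X \<epsilon> (Suc n) A x) =
      end_vertex X \<epsilon> (card A, face_set X \<eta> (Suc n) B x)"
    if AB: "A \<union> B = {1..Suc n}" "A \<inter> B = {}" and n: "Suc n \<in> B" for A B \<epsilon> \<eta>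
  proof -
    define B' where "B' = B - {Suc n}"
    \<comment> \<open>This is the face with which the formation of the B-face of x begins. On it A
      and B' are complementary again, so the induction hypothesis applies.\<close>
    let ?y = "face X \<eta> (Suc n) (Suc n) x"
    have B: "B = insert (Suc n) B'" using n by (auto simp: B'_def)
    have y: "?y \<in> cells X n" using face_closed[of "Suc n" "Suc n" x] Suc.prems by auto
    have A_sub: "A \<subseteq> {1..n}"
    proof
      fix a assume a: "a \<in> A"
      then have "a \<in> {1..Suc n}" "a \<noteq> Suc n" using AB n by auto
      then show "a \<in> {1..n}" by auto
    qed
    moreover have B'_sub: "B' \<subseteq> {1..n}"
    proof
      fix a assume "a \<in> B'"
      then have "a \<in> {1..Suc n}" "a \<noteq> Suc n" using AB by (auto simp: B'_def)
      then show "a \<in> {1..n}" by auto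
    qed
    moreover have "{1..n} \<subseteq> A \<union> B'"
    proof
      fix a assume "a \<in> {1..n}"
      then have "a \<in> A \<union> B" "a \<noteq> Suc n" using AB by auto
      then show "a \<in> A \<union> B'" by (auto simp: B'_def)
    qed
    ultimately have AB': "A \<union> B' = {1..n}" "A \<inter> B' = {}"
      using AB by (auto simp: B'_def)
    have fin: "finite A" "finite B'" using A_sub B'_sub finite_subset by auto
    have "card A + card B' = n" using card_Un_disjoint[OF fin AB'(2)] AB'(1) by simp
    moreover have card_B: "card B = Suc (card B')" unfolding B using fin B'_sub by (subst card_insert_disjoint) auto
    \<comment> \<open>This is the dimension of the A-face, so its last index is
      \<open>card B\<close>.\<close>
    ultimately have card: "card B = Suc n - card A" by simp
    have z: "face_set X \<epsilon> (Suc n) A x \<in> cells X (card B)"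
      using face_set_closed[of A "Suc n" x] AB Suc.prems card by auto
    have "end_vertex X \<epsilon> (card A, face_set X \<eta> (Suc n) B x) =
        end_vertex X \<epsilon> (card A, face_set X \<eta> n B' ?y)"
      unfolding B by (simp add: face_set_Suc[OF B'_sub])
    also have "\<dots> = end_vertex X \<eta> (card B', face_set X \<epsilon> n A ?y)"
      using Suc.IH[OF AB' y] by simp
    also have "face_set X \<epsilon> n A ?y = face X \<eta> (card B) (card B) (face_set X \<epsilon> (Suc n) A x)"
      using face_set_last_face[OF A_sub] Suc.prems card by simp
    also have "end_vertex X \<eta> (card B', \<dots>) = end_vertex X \<eta> (card B, face_set X \<epsilon> (Suc n) A x)"
      using end_vertex_face[OF _ _ z, of "card B" \<eta>] card_B by simp
    finally show ?thesis by simp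
  qed
  have "Suc n \<in> A \<union> B" using Suc.prems by simp
  then consider "Suc n \<in> A" | "Suc n \<in> B" by auto
  then show ?case
  proof cases
    case 1
    then show ?thesis using *[of B A \<epsilon> \<eta>] Suc.prems by (simp add: Un_commute Int_commute)
  next
    case 2
    then show ?thesis using *[of A B] Suc.prems by simp
  qed
qed

section \<open>Cube chains, their splittings and dimensions\<close>

lemma cube_chains_Nil: "[] \<in> cube_chains X v w \<longleftrightarrow> v \<in> cells X 0 \<and> v = w"
  by (auto simp: cube_chains_def)

lemma cube_chains_Cons:
  "(n, x) # c \<in> cube_chains X v w \<longleftrightarrow>
    n > 0 \<and> x \<in> cells X n \<and> end_vertex X False (n, x) = v \<and>
    c \<in> cube_chains X (end_vertex X True (n, x)) w"
proof (cases c)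
  case Nil
  then show ?thesis using end_vertex_closed by (auto simp: cube_chains_def)
next
  case (Cons p c')
  have "(\<forall>k. Suc k < length ((n, x) # c) \<longrightarrow>
        end_vertex X True (((n, x) # c) ! k) = end_vertex X False (((n, x) # c) ! Suc k)) \<longleftrightarrow>
      end_vertex X True (n, x) = end_vertex X False p \<and>
      (\<forall>k. Suc k < length c \<longrightarrow> end_vertex X True (c ! k) = end_vertex X False (c ! Suc k))"
    (is "?L \<longleftrightarrow> ?R")
  proof
    assume L: ?L
    show ?R using L[rule_format, of 0] L[rule_format, of "Suc _"] by (auto simp: Cons)
  next
    assume ?R
    then show ?L by (auto simp: Cons nth_Cons split: nat.splits)
  qed
  then show ?thesis using end_vertex_closed[of x n] by (auto simp: cube_chains_def Cons)
qed

lemma cube_chains_append: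
  "c @ d \<in> cube_chains X v w \<longleftrightarrow> (\<exists>u. c \<in> cube_chains X v u \<and> d \<in> cube_chains X u w)"
proof (induction c arbitrary: v)
  case Nil
  \<comment> \<open>The empty chain exists only at a vertex, so v must be known to be one in order
    to serve as the middle vertex.\<close>
  have "d \<in> cube_chains X v w \<Longrightarrow> v \<in> cells X 0" by (simp add: cube_chains_def)
  then show ?case by (auto simp: cube_chains_Nil)
next
  case (Cons p c)
  then show ?case by (cases p) (auto simp: cube_chains_Cons)
qed

text \<open>Each cube contributes at least 1 to the total length. Hence the subtraction in
  \<open>chain_dim\<close> is never truncated.\<close>

lemma cube_chains_length_le:
  assumes "c \<in> cube_chains X v w"
  shows "length c \<le> chain_length c"
  using assms
proof (induction c arbitrary: v)
  case (Cons p c)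
  obtain n x where p: "p = (n, x)" by fastforce
  have "n > 0" "c \<in> cube_chains X (end_vertex X True (n, x)) w"
    using Cons.prems by (auto simp: p cube_chains_Cons)
  with Cons.IH[of "end_vertex X True (n, x)"] show ?case by (simp add: p chain_length_def)
qed (simp add: chain_length_def)

text \<open>The lower face keeps the start vertex of the cube, the upper face keeps its end vertex,
  and \<open>end_vertex_complementary_faces\<close> joins them in between. The total length is
  unchanged while the number of cubes grows by one, so the dimension drops by one.\<close>

lemma split_chain_closed:
  assumes c: "c \<in> cube_chains X v w" and k: "1 \<le> k" "k \<le> length c"
    and I: "I \<subseteq> {1..fst (c ! (k - 1))}" "0 < card I" "card I < fst (c ! (k - 1))"
  shows "split_chain X k I c \<in> cube_chains X v w"
    and "chain_dim (split_chain X k I c) + 1 = chain_dim c"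
proof -
  obtain n x where nx: "c ! (k - 1) = (n, x)" by fastforce
  have k': "Suc (k - 1) = k" "k - 1 < length c" using k by auto
  have dec: "c = take (k - 1) c @ (n, x) # drop k c"
    using id_take_nth_drop[OF k'(2)] nx k'(1) by simp
  let ?A = "{1..n} - I"
  have AI: "?A \<union> I = {1..n}" "?A \<inter> I = {}" using I nx by auto
  have card_A: "card ?A = n - card I"
    using I nx by (subst card_Diff_subset) (auto intro: finite_subset)
  then have card_A': "n - card ?A = card I" using I nx by auto
  have split: "split_chain X k I c = take (k - 1) c @
      (card I, face_set X False n ?A x) # (n - card I, face_set X True n I x) # drop k c"
    unfolding split_chain_def nx by simp
  have "take (k - 1) c @ (n, x) # drop k c \<in> cube_chains X v w" using dec c by simp
  then obtain u where u: "take (k - 1) c \<in> cube_chains X v u"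
    "(n, x) # drop k c \<in> cube_chains X u w" by (auto simp: cube_chains_append)
  then have x: "x \<in> cells X n" "end_vertex X False (n, x) = u" and n: "n > 0"
    and d: "drop k c \<in> cube_chains X (end_vertex X True (n, x)) w"
    by (auto simp: cube_chains_Cons)
  have "(card I, face_set X False n ?A x) # (n - card I, face_set X True n I x) # drop k c
      \<in> cube_chains X u w"
    using face_set_closed[of ?A n x False] face_set_closed[of I n x True]
      end_vertex_face_set[of ?A n x False] end_vertex_face_set[of I n x True]
      end_vertex_complementary_faces[OF AI x(1), of True False] I nx x d
    unfolding card_A card_A' by (simp add: cube_chains_Cons)
  with u(1) show "split_chain X k I c \<in> cube_chains X v w"
    unfolding split cube_chains_append by blast
  have 1: "length (take (k - 1) c) \<le> chain_length (take (k - 1) c)"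
    using u(1) by (rule cube_chains_length_le)
  have 2: "length (drop k c) \<le> chain_length (drop k c)"
    using d by (rule cube_chains_length_le)
  have 3: "card I < n" "0 < card I" using I nx by auto
  have "chain_length c = chain_length (take (k - 1) c) + n + chain_length (drop k c)"
    by (subst dec) (simp add: chain_length_def)
  moreover have "length c = length (take (k - 1) c) + 1 + length (drop k c)"
    by (subst dec) simp
  moreover have "chain_length (split_chain X k I c) =
      chain_length (take (k - 1) c) + n + chain_length (drop k c)"
    unfolding split chain_length_def using 3 by simp
  moreover have "length (split_chain X k I c) = length (take (k - 1) c) + 2 + length (drop k c)"
    unfolding split by simp
  ultimately show "chain_dim (split_chain X k I c) + 1 = chain_dim c"
    using 1 2 3 unfolding chain_dim_def by linarith
qed

lemma chain_dim_append:
  assumes "c \<in> cube_chains X u v" "d \<in> cube_chains X v w"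
  shows "chain_dim (c @ d) = chain_dim c + chain_dim d"
proof -
  have "length c \<le> chain_length c" "length d \<le> chain_length d"
    using assms cube_chains_length_le by auto
  then show ?thesis by (simp add: chain_dim_def chain_length_def)
qed

end

section \<open>The Leibniz rule and the product on homology\<close>

locale cube_chain_complex = precubical_set X + R?: cring R
  for X :: "'a precubical" and R :: "('r, 'm) ring_scheme" (structure)
begin

declare One_nat_def [simp del]

section \<open>Chain modules and the boundary as a linear map\<close>

abbreviation C :: "nat \<Rightarrow> 'a \<Rightarrow> 'a \<Rightarrow> ('r, 'a cchain \<Rightarrow> 'r) module" where
  "C \<equiv> chain_module R X"

definition chain_basis :: "nat \<Rightarrow> 'a \<Rightarrow> 'a \<Rightarrow> 'a cchain set" where
  "chain_basis n v w = {c \<in> cube_chains X v w. chain_dim c + 1 = n}"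

lemma C_eq: "C n v w = free_module R (chain_basis n v w)"
  by (simp add: chain_module_def chain_basis_def)

lemma module_C: "module R (C n v w)"
  unfolding C_eq by (rule module_free_module) (rule R.is_cring)

lemma basis_elt_C: "c \<in> chain_basis n v w \<Longrightarrow> basis_elt R c \<in> carrier (C n v w)"
  unfolding C_eq by (rule basis_elt_closed) (rule R.is_cring)

lemma chain_basis_append:
  assumes "c \<in> chain_basis i u v" "d \<in> chain_basis j v w"
  shows "c @ d \<in> chain_basis (i + j - 1) u w"
  using assms chain_dim_append[of c u v d w]
  by (auto simp: chain_basis_def cube_chains_append)

text \<open>Coefficient and sum are separated by position so that the Leibniz rule can compare the
  contributions of single cubes.\<close>

definition split_coeff :: "'a cchain \<Rightarrow> nat \<Rightarrow> nat \<Rightarrow> nat set \<Rightarrow> 'r" where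
  "split_coeff c k r I =
    (\<ominus> \<one>) [^] ((\<Sum>p=1..<k. fst (c ! (p - 1))) + k + r + 1) \<otimes> subset_sign R I"

definition split_sum :: "('r, 'a cchain \<Rightarrow> 'r) module \<Rightarrow> 'a cchain \<Rightarrow> nat \<Rightarrow> 'a cchain \<Rightarrow> 'r" where
  "split_sum M c k =
    (\<Oplus>\<^bsub>M\<^esub>r\<in>{1..fst (c ! (k - 1)) - 1}. \<Oplus>\<^bsub>M\<^esub>I\<in>{I. I \<subseteq> {1..fst (c ! (k - 1))} \<and> card I = r}.
      split_coeff c k r I \<odot>\<^bsub>M\<^esub> basis_elt R (split_chain X k I c))"

lemma boundary_chain_eq:
  "boundary_chain R X n v w c = (\<Oplus>\<^bsub>C (n - 1) v w\<^esub>k\<in>{1..length c}. split_sum (C (n - 1) v w) c k)"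
  by (simp add: boundary_chain_def split_sum_def split_coeff_def Let_def)

lemma subset_sign_closed: "subset_sign R I \<in> carrier R"
  by (simp add: subset_sign_def)

lemma split_coeff_closed: "split_coeff c k r I \<in> carrier R"
  by (simp add: split_coeff_def subset_sign_closed)

text \<open>The range of r makes I nonempty and proper, so both new cubes have positive
  dimension.\<close>

lemma split_chain_basis:
  assumes "c \<in> chain_basis n v w" "1 \<le> k" "k \<le> length c"
    and "r \<in> {1..fst (c ! (k - 1)) - 1}" "I \<subseteq> {1..fst (c ! (k - 1))}" "card I = r"
  shows "split_chain X k I c \<in> chain_basis (n - 1) v w"
  using assms split_chain_closed[of c v w k I] by (auto simp: chain_basis_def)

text \<open>All terms are multiples of basis elements in the carrier, so h passes through both sums.
  The same membership facts give closure, which is therefore stated here too; where only closure is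
  wanted, the identity serves as h.\<close>

lemma split_sum_hom:
  assumes c: "c \<in> chain_basis n v w" and k: "1 \<le> k" "k \<le> length c"
    and N: "module R N" and h: "h \<in> module_hom R (C (n - 1) v w) N"
  shows "h (split_sum (C (n - 1) v w) c k) =
    (\<Oplus>\<^bsub>N\<^esub>r\<in>{1..fst (c ! (k - 1)) - 1}. \<Oplus>\<^bsub>N\<^esub>I\<in>{I. I \<subseteq> {1..fst (c ! (k - 1))} \<and> card I = r}.
      split_coeff c k r I \<odot>\<^bsub>N\<^esub> h (basis_elt R (split_chain X k I c)))"
    (is ?hom)
    and "split_sum (C (n - 1) v w) c k \<in> carrier (C (n - 1) v w)" (is ?closed)
proof -
  interpret C: module R "C (n - 1) v w" by (rule module_C)
  interpret N: module R N by fact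
  have e: "basis_elt R (split_chain X k I c) \<in> carrier (C (n - 1) v w)"
    if "r \<in> {1..fst (c ! (k - 1)) - 1}" "I \<in> {I. I \<subseteq> {1..fst (c ! (k - 1))} \<and> card I = r}" for r I
    using that by (intro basis_elt_C split_chain_basis[OF c k]) auto
  note [simp] = split_coeff_closed
  have inner: "(\<lambda>I. split_coeff c k r I \<odot>\<^bsub>C (n - 1) v w\<^esub> basis_elt R (split_chain X k I c))
      \<in> {I. I \<subseteq> {1..fst (c ! (k - 1))} \<and> card I = r} \<rightarrow> carrier (C (n - 1) v w)"
    if "r \<in> {1..fst (c ! (k - 1)) - 1}" for r
    using e[OF that] by (intro Pi_I C.smult_closed) auto
  have outer: "(\<lambda>r. \<Oplus>\<^bsub>C (n - 1) v w\<^esub>I\<in>{I. I \<subseteq> {1..fst (c ! (k - 1))} \<and> card I = r}.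
      split_coeff c k r I \<odot>\<^bsub>C (n - 1) v w\<^esub> basis_elt R (split_chain X k I c))
      \<in> {1..fst (c ! (k - 1)) - 1} \<rightarrow> carrier (C (n - 1) v w)"
    by (intro Pi_I C.M.finsum_closed inner)
  show ?closed unfolding split_sum_def by (intro C.M.finsum_closed outer)
  have "h (split_sum (C (n - 1) v w) c k) =
      (\<Oplus>\<^bsub>N\<^esub>r\<in>{1..fst (c ! (k - 1)) - 1}. h (\<Oplus>\<^bsub>C (n - 1) v w\<^esub>I\<in>{I. I \<subseteq> {1..fst (c ! (k - 1))} \<and> card I = r}.
        split_coeff c k r I \<odot>\<^bsub>C (n - 1) v w\<^esub> basis_elt R (split_chain X k I c)))"
    unfolding split_sum_def by (rule module_hom_finsum[OF module_C N h outer])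
  also have "\<dots> = (\<Oplus>\<^bsub>N\<^esub>r\<in>{1..fst (c ! (k - 1)) - 1}. \<Oplus>\<^bsub>N\<^esub>I\<in>{I. I \<subseteq> {1..fst (c ! (k - 1))} \<and> card I = r}.
      split_coeff c k r I \<odot>\<^bsub>N\<^esub> h (basis_elt R (split_chain X k I c)))"
  proof (rule N.M.finsum_cong')
    fix r assume r: "r \<in> {1..fst (c ! (k - 1)) - 1}"
    have "h (\<Oplus>\<^bsub>C (n - 1) v w\<^esub>I\<in>{I. I \<subseteq> {1..fst (c ! (k - 1))} \<and> card I = r}.
          split_coeff c k r I \<odot>\<^bsub>C (n - 1) v w\<^esub> basis_elt R (split_chain X k I c)) =
        (\<Oplus>\<^bsub>N\<^esub>I\<in>{I. I \<subseteq> {1..fst (c ! (k - 1))} \<and> card I = r}.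
          h (split_coeff c k r I \<odot>\<^bsub>C (n - 1) v w\<^esub> basis_elt R (split_chain X k I c)))"
      by (rule module_hom_finsum[OF module_C N h inner[OF r]])
    also have "\<dots> = (\<Oplus>\<^bsub>N\<^esub>I\<in>{I. I \<subseteq> {1..fst (c ! (k - 1))} \<and> card I = r}.
        split_coeff c k r I \<odot>\<^bsub>N\<^esub> h (basis_elt R (split_chain X k I c)))"
      by (rule N.M.finsum_cong')
        (use e[OF r] in \<open>auto intro!: N.smult_closed module_homD(1)[OF h] simp: module_homD(3)[OF h]
          \<close>)
    finally show "h (\<Oplus>\<^bsub>C (n - 1) v w\<^esub>I\<in>{I. I \<subseteq> {1..fst (c ! (k - 1))} \<and> card I = r}.
          split_coeff c k r I \<odot>\<^bsub>C (n - 1) v w\<^esub> basis_elt R (split_chain X k I c)) =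
        (\<Oplus>\<^bsub>N\<^esub>I\<in>{I. I \<subseteq> {1..fst (c ! (k - 1))} \<and> card I = r}.
          split_coeff c k r I \<odot>\<^bsub>N\<^esub> h (basis_elt R (split_chain X k I c)))" .
  next
    show "(\<lambda>r. \<Oplus>\<^bsub>N\<^esub>I\<in>{I. I \<subseteq> {1..fst (c ! (k - 1))} \<and> card I = r}.
        split_coeff c k r I \<odot>\<^bsub>N\<^esub> h (basis_elt R (split_chain X k I c)))
        \<in> {1..fst (c ! (k - 1)) - 1} \<rightarrow> carrier N"
      using e by (intro Pi_I N.M.finsum_closed N.smult_closed module_homD(1)[OF h]) auto
  qed simp
  finally show ?hom .
qed

lemma boundary_chain_closed:
  assumes "c \<in> chain_basis n v w"
  shows "boundary_chain R X n v w c \<in> carrier (C (n - 1) v w)"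
proof -
  interpret C: module R "C (n - 1) v w" by (rule module_C)
  have "(\<lambda>x. x) \<in> module_hom R (C (n - 1) v w) (C (n - 1) v w)" by (simp add: module_hom_def)
  then show ?thesis unfolding boundary_chain_eq
    by (intro C.M.finsum_closed Pi_I split_sum_hom(2)[OF assms _ _ module_C]) auto
qed

lemma boundary_eq: "boundary R X n v w = lin_ext R (C (n - 1) v w) (boundary_chain R X n v w)"
  by (simp add: fun_eq_iff boundary_def lin_ext_def Let_def)

lemma boundary_hom: "boundary R X n v w \<in> module_hom R (C n v w) (C (n - 1) v w)"
  unfolding boundary_eq by (subst (1) C_eq) (intro lin_ext_hom module_C Pi_I boundary_chain_closed)

lemma boundary_basis_elt:
  "c \<in> chain_basis n v w \<Longrightarrow> boundary R X n v w (basis_elt R c) = boundary_chain R X n v w c"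
  unfolding boundary_eq by (intro lin_ext_basis_elt module_C Pi_I boundary_chain_closed)

section \<open>Concatenation as a bilinear map\<close>

lemma inner_concat_hom:
  assumes "c \<in> chain_basis i u v"
  shows "lin_ext R (C (i + j - 1) u w) (\<lambda>d. basis_elt R (c @ d)) \<in>
    module_hom R (C j v w) (C (i + j - 1) u w)"
  by (subst (2) C_eq) (intro lin_ext_hom module_C Pi_I basis_elt_C chain_basis_append[OF assms])

text \<open>Pulling the factor \<open>f c\<close> out of the inner sum exhibits the double sum as a
  linear extension of linear extensions, from which linearity in each argument can be read
  off.\<close>

lemma concat_chains_eq:
  assumes f: "f \<in> carrier (C i u v)" and g: "g \<in> carrier (C j v w)"
  shows "concat_chains R X i j u w f g =
    lin_ext R (C (i + j - 1) u w)
      (\<lambda>c. lin_ext R (C (i + j - 1) u w) (\<lambda>d. basis_elt R (c @ d)) g) f"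
proof -
  interpret M: module R "C (i + j - 1) u w" by (rule module_C)
  have f': "finite {c. f c \<noteq> \<zero>}" "\<And>c. f c \<noteq> \<zero> \<Longrightarrow> c \<in> chain_basis i u v" "\<And>c. f c \<in> carrier R"
    using f by (auto simp: C_eq free_module_simps)
  have g': "finite {d. g d \<noteq> \<zero>}" "\<And>d. g d \<noteq> \<zero> \<Longrightarrow> d \<in> chain_basis j v w" "\<And>d. g d \<in> carrier R"
    using g by (auto simp: C_eq free_module_simps)
  have e: "basis_elt R (c @ d) \<in> carrier (C (i + j - 1) u w)" if "f c \<noteq> \<zero>" "g d \<noteq> \<zero>" for c d
    using that f' g' by (intro basis_elt_C chain_basis_append) auto
  have "(\<Oplus>\<^bsub>C (i + j - 1) u w\<^esub>d\<in>{d. g d \<noteq> \<zero>}. (f c \<otimes> g d) \<odot>\<^bsub>C (i + j - 1) u w\<^esub> basis_elt R (c @ d)) =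
      f c \<odot>\<^bsub>C (i + j - 1) u w\<^esub> lin_ext R (C (i + j - 1) u w) (\<lambda>d. basis_elt R (c @ d)) g"
    if c: "f c \<noteq> \<zero>" for c
    unfolding lin_ext_def
    by (subst M.finsum_smult_ldistr)
      (use f' g' e[OF c] in \<open>auto simp: M.smult_assoc1 Pi_iff intro!: M.M.finsum_cong' M.smult_closed\<close>)
  then show ?thesis
    unfolding concat_chains_def Let_def lin_ext_def[of R _ _ f]
    by (intro M.M.finsum_cong')
      (use f' g in \<open>auto intro!: M.smult_closed module_homD(1)[OF inner_concat_hom]\<close>)
qed

lemma concat_hom_left:
  assumes g: "g \<in> carrier (C j v w)"
  shows "(\<lambda>f. concat_chains R X i j u w f g) \<in> module_hom R (C i u v) (C (i + j - 1) u w)"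
proof (rule module_hom_cong)
  show "lin_ext R (C (i + j - 1) u w)
      (\<lambda>c. lin_ext R (C (i + j - 1) u w) (\<lambda>d. basis_elt R (c @ d)) g)
    \<in> module_hom R (C i u v) (C (i + j - 1) u w)"
    by (subst (3) C_eq) (intro lin_ext_hom module_C Pi_I module_homD(1)[OF inner_concat_hom g])
qed (use concat_chains_eq g module_C in auto)

text \<open>The extension in g sits inside the sum over f, so linearity comes from
  \<open>lin_ext_hom_param\<close>.\<close>

lemma concat_hom_right:
  assumes f: "f \<in> carrier (C i u v)"
  shows "concat_chains R X i j u w f \<in> module_hom R (C j v w) (C (i + j - 1) u w)"
proof (rule module_hom_cong)
  show "(\<lambda>g. lin_ext R (C (i + j - 1) u w)
      (\<lambda>c. lin_ext R (C (i + j - 1) u w) (\<lambda>d. basis_elt R (c @ d)) g) f)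
    \<in> module_hom R (C j v w) (C (i + j - 1) u w)"
    using f by (intro lin_ext_hom_param[where B = "chain_basis i u v"] module_C inner_concat_hom)
      (simp add: C_eq)
qed (use concat_chains_eq f module_C in auto)

lemma concat_basis_elt:
  assumes c: "c \<in> chain_basis i u v" and d: "d \<in> chain_basis j v w"
  shows "concat_chains R X i j u w (basis_elt R c) (basis_elt R d) = basis_elt R (c @ d)"
proof -
  have "concat_chains R X i j u w (basis_elt R c) (basis_elt R d) =
      lin_ext R (C (i + j - 1) u w) (\<lambda>d. basis_elt R (c @ d)) (basis_elt R d)"
    using concat_chains_eq[OF basis_elt_C[OF c] basis_elt_C[OF d]]
    by (simp add: lin_ext_basis_elt[OF module_C c] module_homD(1)[OF inner_concat_hom basis_elt_C[OF d]])
  also have "\<dots> = basis_elt R (c @ d)"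
    by (intro lin_ext_basis_elt[OF module_C d] Pi_I basis_elt_C chain_basis_append[OF c])
  finally show ?thesis .
qed

section \<open>Signs, splittings and the Leibniz rule\<close>

definition dim_sign :: "nat \<Rightarrow> 'r" where
  "dim_sign n = (\<ominus> \<one>) [^] (n - 1)"

lemma dim_sign_closed: "dim_sign n \<in> carrier R"
  by (simp add: dim_sign_def)

lemma neg_one_pow_even: "(\<ominus> \<one>) [^] (2 * n :: nat) = \<one>"
proof -
  have "(\<ominus> \<one>) [^] (2 * n) = ((\<ominus> \<one>) [^] (2::nat)) [^] n"
    by (simp add: nat_pow_pow)
  also have "(\<ominus> \<one>) [^] (2::nat) = \<one>"
    by (simp add: numeral_2_eq_2 l_minus r_minus)
  finally show ?thesis by simp
qed

lemma sum_dims_append: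
  assumes "1 \<le> k"
  shows "(\<Sum>p=1..<length c + k. fst ((c @ d) ! (p - 1))) =
    chain_length c + (\<Sum>p=1..<k. fst (d ! (p - 1)))"
proof -
  \<comment> \<open>Positions are counted from 1. After the shift the sums run over initial
    segments, which split at \<open>length c\<close>.\<close>
  have shift: "(\<Sum>p=1..<m. f (p - 1)) = (\<Sum>p<m - 1. f p)" for m and f :: "nat \<Rightarrow> nat"
    by (rule sum.reindex_bij_witness[of _ Suc "\<lambda>p. p - 1"]) auto
  have "(\<Sum>p<length c + m. fst ((c @ d) ! p)) =
      (\<Sum>p<length c. fst ((c @ d) ! p)) + (\<Sum>p<m. fst ((c @ d) ! (length c + p)))" for m
    by (induction m) auto
  from this[of "k - 1"] show ?thesis
    unfolding shift[of "\<lambda>p. fst ((c @ d) ! p)"] shift[of "\<lambda>p. fst (d ! p)"] using assms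
    by (simp add: chain_length_def sum_list_sum_nth atLeast0LessThan nth_append)
qed

lemma split_coeff_append_right:
  assumes c: "c \<in> chain_basis i u v" and k: "1 \<le> k"
  shows "split_coeff (c @ d) (length c + k) r I = dim_sign i \<otimes> split_coeff d k r I"
proof -
  have "length c \<le> chain_length c" "i - 1 = chain_length c - length c"
    using c cube_chains_length_le by (auto simp: chain_basis_def chain_dim_def)
  \<comment> \<open>The term \<open>2 * length c\<close> compensates for the subtraction in
    \<open>chain_dim\<close> and disappears in the exponent of -1.\<close>
  then have len: "chain_length c + length c = (i - 1) + 2 * length c" by simp
  define m where "m = (\<Sum>p=1..<k. fst (d ! (p - 1))) + k + r + 1"
  have "split_coeff (c @ d) (length c + k) r I =
      (\<ominus> \<one>) [^] ((i - 1) + 2 * length c + m) \<otimes> subset_sign R I"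
    unfolding split_coeff_def sum_dims_append[OF k] len[symmetric] m_def by (simp add: ac_simps)
  also have "(\<ominus> \<one>) [^] ((i - 1) + 2 * length c + m) = dim_sign i \<otimes> (\<ominus> \<one>) [^] m"
    by (simp only: nat_pow_mult[symmetric] R.add.inv_closed R.one_closed neg_one_pow_even dim_sign_def a_inv_closed) simp
  finally show ?thesis
    by (simp add: split_coeff_def m_def m_assoc dim_sign_closed subset_sign_closed)
qed

lemma split_coeff_append_left:
  assumes "1 \<le> k" "k \<le> length c"
  shows "split_coeff (c @ d) k r I = split_coeff c k r I"
proof -
  have "(\<Sum>p=1..<k. fst ((c @ d) ! (p - 1))) = (\<Sum>p=1..<k. fst (c ! (p - 1)))"
    by (rule sum.cong) (use assms in \<open>auto simp: nth_append\<close>)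
  then show ?thesis by (simp add: split_coeff_def)
qed

lemma split_chain_append_left:
  assumes "1 \<le> k" "k \<le> length c"
  shows "split_chain X k I (c @ d) = split_chain X k I c @ d"
  using assms by (auto simp: split_chain_def nth_append Let_def split: prod.splits)

lemma split_chain_append_right:
  assumes "1 \<le> k"
  shows "split_chain X (length c + k) I (c @ d) = c @ split_chain X k I d"
  using assms by (auto simp: split_chain_def nth_append Let_def split: prod.splits)

text \<open>The sum over positions in \<open>c @ d\<close> is cut after \<open>length c\<close>.
  Each product on the right is packaged as a linear map, \<open>hl\<close> or \<open>hr\<close>,
  which can be pushed through the boundary sum of c or d and matched position by position.\<close>

lemma boundary_chain_append:
  assumes c: "c \<in> chain_basis i u v" and d: "d \<in> chain_basis j v w"
  shows "boundary_chain R X (i + j - 1) u w (c @ d) =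
    concat_chains R X (i - 1) j u w (boundary_chain R X i u v c) (basis_elt R d)
    \<oplus>\<^bsub>C (i + j - 1 - 1) u w\<^esub>
    dim_sign i \<odot>\<^bsub>C (i + j - 1 - 1) u w\<^esub>
      concat_chains R X i (j - 1) u w (basis_elt R c) (boundary_chain R X j v w d)"
proof -
  have ij: "i \<ge> 1" "j \<ge> 1" using c d by (auto simp: chain_basis_def)
  \<comment> \<open>Subtraction is truncated, so positivity of i and j is what makes the module
    indices of all three terms equal.\<close>
  then have deg: "i - 1 + j - 1 = i + j - 1 - 1" "i + (j - 1) - 1 = i + j - 1 - 1" by auto
  let ?N = "C (i + j - 1 - 1) u w"
  interpret N: module R ?N by (rule module_C)
  define hl where "hl = (\<lambda>f. concat_chains R X (i - 1) j u w f (basis_elt R d))"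
  define hr where "hr = (\<lambda>g. dim_sign i \<odot>\<^bsub>?N\<^esub> concat_chains R X i (j - 1) u w (basis_elt R c) g)"
  have hl: "hl \<in> module_hom R (C (i - 1) u v) ?N"
    using concat_hom_left[OF basis_elt_C[OF d], of "i - 1" u] unfolding hl_def deg .
  have hr: "hr \<in> module_hom R (C (j - 1) v w) ?N"
    using concat_hom_right[OF basis_elt_C[OF c], of "j - 1" w] unfolding hr_def deg
    by (intro module_hom_smult module_C dim_sign_closed)
  have left: "split_sum ?N (c @ d) k = hl (split_sum (C (i - 1) u v) c k)"
    if k: "k \<in> {1..length c}" for k
  proof -
    have dim: "fst ((c @ d) ! (k - 1)) = fst (c ! (k - 1))" using k by (auto simp: nth_append)
    have "hl (basis_elt R (split_chain X k I c)) = basis_elt R (split_chain X k I (c @ d))"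
      if "I \<subseteq> {1..fst (c ! (k - 1))}" "card I \<in> {1..fst (c ! (k - 1)) - 1}" for I
      using that k concat_basis_elt[OF split_chain_basis[OF c _ _ that(2,1) refl] d]
      by (simp add: hl_def split_chain_append_left)
    moreover have "basis_elt R (split_chain X k I (c @ d)) \<in> carrier ?N"
      if "I \<subseteq> {1..fst (c ! (k - 1))}" "card I \<in> {1..fst (c ! (k - 1)) - 1}" for I
      using split_chain_basis[OF chain_basis_append[OF c d], of k _ I] k that dim
      by (intro basis_elt_C) auto
    moreover have "split_coeff (c @ d) k r I = split_coeff c k r I" for r I
      using k by (simp add: split_coeff_append_left)
    moreover have k': "1 \<le> k" "k \<le> length c" using k by auto
    ultimately show ?thesis
      unfolding split_sum_hom(1)[OF c k' module_C hl]
      unfolding split_sum_def dim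
      by (intro N.M.finsum_cong' Pi_I N.M.finsum_closed N.smult_closed split_coeff_closed refl) auto
  qed
  have right: "split_sum ?N (c @ d) (length c + k) = hr (split_sum (C (j - 1) v w) d k)"
    if k: "k \<in> {1..length d}" for k
  proof -
    have dim: "fst ((c @ d) ! (length c + k - 1)) = fst (d ! (k - 1))"
      using k by (auto simp: nth_append)
    have e: "basis_elt R (split_chain X (length c + k) I (c @ d)) \<in> carrier ?N"
      if "I \<subseteq> {1..fst (d ! (k - 1))}" "card I \<in> {1..fst (d ! (k - 1)) - 1}" for I
      using split_chain_basis[OF chain_basis_append[OF c d], of "length c + k" _ I] k that dim
      by (intro basis_elt_C) auto
    \<comment> \<open>Pushing \<open>hr\<close> inside leaves the sign next to the basis element;
      commutativity moves it in front, where it completes the coefficient belonging to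
      \<open>c @ d\<close>.\<close>
    have swap: "split_coeff d k r I \<odot>\<^bsub>?N\<^esub> (dim_sign i \<odot>\<^bsub>?N\<^esub> x) =
        (dim_sign i \<otimes> split_coeff d k r I) \<odot>\<^bsub>?N\<^esub> x" if "x \<in> carrier ?N" for x r I
      using N.smult_assoc1[OF split_coeff_closed dim_sign_closed that]
        m_comm[OF split_coeff_closed dim_sign_closed] by metis
    have "split_coeff d k r I \<odot>\<^bsub>?N\<^esub> hr (basis_elt R (split_chain X k I d)) =
        split_coeff (c @ d) (length c + k) r I \<odot>\<^bsub>?N\<^esub>
          basis_elt R (split_chain X (length c + k) I (c @ d))"
      if "I \<subseteq> {1..fst (d ! (k - 1))}" "card I \<in> {1..fst (d ! (k - 1)) - 1}" for r I
      using that k swap[OF e[OF that]] concat_basis_elt[OF c split_chain_basis[OF d _ _ that(2,1) refl]]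
      by (simp add: hr_def split_chain_append_right split_coeff_append_right[OF c])
    moreover have k': "1 \<le> k" "k \<le> length d" using k by auto
    ultimately have "hr (split_sum (C (j - 1) v w) d k) = split_sum ?N (c @ d) (length c + k)"
      using e
      unfolding split_sum_hom(1)[OF d k' module_C hr]
      unfolding split_sum_def dim
      by (intro N.M.finsum_cong' Pi_I N.M.finsum_closed N.smult_closed split_coeff_closed refl) auto
    then show ?thesis by (rule sym)
  qed
  have id: "(\<lambda>x. x) \<in> module_hom R M M" for M :: "('r, 'a cchain \<Rightarrow> 'r) module"
    by (simp add: module_hom_def)
  have cl: "split_sum ?N (c @ d) k \<in> carrier ?N" if "k \<in> {1..length (c @ d)}" for k
    using that by (intro split_sum_hom(2)[OF chain_basis_append[OF c d] _ _ module_C id]) auto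
  have clc: "split_sum (C (i - 1) u v) c \<in> {1..length c} \<rightarrow> carrier (C (i - 1) u v)"
    by (intro Pi_I split_sum_hom(2)[OF c _ _ module_C id]) auto
  have cld: "split_sum (C (j - 1) v w) d \<in> {1..length d} \<rightarrow> carrier (C (j - 1) v w)"
    by (intro Pi_I split_sum_hom(2)[OF d _ _ module_C id]) auto
  have part: "{1..length (c @ d)} = {1..length c} \<union> (+) (length c) ` {1..length d}"
    by (auto simp: image_iff)
  have "boundary_chain R X (i + j - 1) u w (c @ d) =
      (\<Oplus>\<^bsub>?N\<^esub>k\<in>{1..length c}. split_sum ?N (c @ d) k) \<oplus>\<^bsub>?N\<^esub>
      (\<Oplus>\<^bsub>?N\<^esub>k\<in>(+) (length c) ` {1..length d}. split_sum ?N (c @ d) k)"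
    unfolding boundary_chain_eq part
    by (rule N.M.finsum_Un_disjoint) (use cl in auto)
  also have "(\<Oplus>\<^bsub>?N\<^esub>k\<in>(+) (length c) ` {1..length d}. split_sum ?N (c @ d) k) =
      (\<Oplus>\<^bsub>?N\<^esub>k\<in>{1..length d}. split_sum ?N (c @ d) (length c + k))"
    by (rule N.M.finsum_reindex) (use cl in \<open>auto simp: inj_on_def\<close>)
  also have "\<dots> = (\<Oplus>\<^bsub>?N\<^esub>k\<in>{1..length d}. hr (split_sum (C (j - 1) v w) d k))"
    by (rule N.M.finsum_cong') (use right cld module_homD(1)[OF hr] in auto)
  also have "\<dots> = hr (boundary_chain R X j v w d)"
    unfolding boundary_chain_eq
    by (rule module_hom_finsum[OF module_C module_C hr cld, symmetric])
  also have "(\<Oplus>\<^bsub>?N\<^esub>k\<in>{1..length c}. split_sum ?N (c @ d) k) =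
      (\<Oplus>\<^bsub>?N\<^esub>k\<in>{1..length c}. hl (split_sum (C (i - 1) u v) c k))"
    by (rule N.M.finsum_cong') (use left clc module_homD(1)[OF hl] in auto)
  also have "\<dots> = hl (boundary_chain R X i u v c)"
    unfolding boundary_chain_eq
    by (rule module_hom_finsum[OF module_C module_C hl clc, symmetric])
  finally show ?thesis by (simp add: hl_def hr_def)
qed

text \<open>With one argument fixed, both sides are linear in the other. Hence f and then g may be
  replaced by basis chains, which leaves \<open>boundary_chain_append\<close>.\<close>

lemma boundary_concat:
  assumes f: "f \<in> carrier (C i u v)" and g: "g \<in> carrier (C j v w)" and ij: "i \<ge> 1" "j \<ge> 1"
  shows "boundary R X (i + j - 1) u w (concat_chains R X i j u w f g) =
    concat_chains R X (i - 1) j u w (boundary R X i u v f) g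
    \<oplus>\<^bsub>C (i + j - 1 - 1) u w\<^esub>
    dim_sign i \<odot>\<^bsub>C (i + j - 1 - 1) u w\<^esub>
      concat_chains R X i (j - 1) u w f (boundary R X j v w g)"
    (is "?L f g = ?R f g")
proof -
  have deg: "i - 1 + j - 1 = i + j - 1 - 1" "i + (j - 1) - 1 = i + j - 1 - 1" using ij by auto
  let ?N = "C (i + j - 1 - 1) u w"
  have L1: "(\<lambda>f. ?L f g) \<in> module_hom R (C i u v) ?N" if "g \<in> carrier (C j v w)" for g
    by (rule module_hom_comp[OF concat_hom_left[OF that] boundary_hom])
  have L2: "?L f \<in> module_hom R (C j v w) ?N" if "f \<in> carrier (C i u v)" for f
    by (rule module_hom_comp[OF concat_hom_right[OF that] boundary_hom])
  have R1: "(\<lambda>f. ?R f g) \<in> module_hom R (C i u v) ?N" if g: "g \<in> carrier (C j v w)" for g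
    by (intro module_hom_add module_hom_smult module_C dim_sign_closed
        module_hom_comp[OF boundary_hom concat_hom_left[OF g, of "i - 1", unfolded deg]]
        concat_hom_left[of _ "j - 1" v w i, unfolded deg] module_homD(1)[OF boundary_hom g])
  have R2: "?R f \<in> module_hom R (C j v w) ?N" if f: "f \<in> carrier (C i u v)" for f
    by (intro module_hom_add module_hom_smult module_C dim_sign_closed
        module_hom_comp[OF boundary_hom concat_hom_right[OF f, of "j - 1", unfolded deg]]
        concat_hom_right[of _ "i - 1" u v j, unfolded deg] module_homD(1)[OF boundary_hom f])
  show ?thesis
  proof (rule module_hom_eq_on_basis[OF R.is_cring module_C
        L1[OF g, unfolded C_eq[of i]] R1[OF g, unfolded C_eq[of i]] _ f[unfolded C_eq]])
    fix c assume c: "c \<in> chain_basis i u v"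
    note c' = basis_elt_C[OF c]
    show "?L (basis_elt R c) g = ?R (basis_elt R c) g"
    proof (rule module_hom_eq_on_basis[OF R.is_cring module_C
          L2[OF c', unfolded C_eq[of j]] R2[OF c', unfolded C_eq[of j]] _ g[unfolded C_eq]])
      fix d assume d: "d \<in> chain_basis j v w"
      show "?L (basis_elt R c) (basis_elt R d) = ?R (basis_elt R c) (basis_elt R d)"
        using boundary_chain_append[OF c d]
        by (simp add: concat_basis_elt[OF c d] boundary_basis_elt c d
            boundary_basis_elt[OF chain_basis_append[OF c d]])
    qed
  qed
qed

section \<open>Cycles, boundaries and products of homology classes\<close>

lemma submodule_cycles: "submodule (cycles R X n v w) R (C n v w)"
  unfolding cycles_def by (rule submodule_kernel[OF module_C module_C boundary_hom])

lemma submodule_boundaries: "submodule (boundaries R X n v w) R (C n v w)"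
  using submodule_image[OF module_C module_C boundary_hom[of "n + 1" v w]]
  by (simp add: boundaries_def)

lemma module_HM: "module R (HM R X n v w)"
  unfolding HM_def
  by (rule module_quotient_module[OF module_C submodule_boundaries submodule_cycles])

lemma cycles_closed: "f \<in> cycles R X n v w \<Longrightarrow> f \<in> carrier (C n v w)"
  by (simp add: cycles_def)

lemma homology_class_hom:
  "homology_class R X n v w \<in> module_hom R ((C n v w)\<lparr>carrier := cycles R X n v w\<rparr>) (HM R X n v w)"
  unfolding HM_def homology_class_def[abs_def]
  by (intro quotient_map_hom(1) module_C submodule_boundaries subsetI cycles_closed)

lemma carrier_HM: "carrier (HM R X n v w) = homology_class R X n v w ` cycles R X n v w"
  unfolding HM_def homology_class_def[abs_def]
  by (rule quotient_map_hom(2)[OF module_C submodule_boundaries]) (auto dest: cycles_closed)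

lemma homology_class_eq_iff:
  assumes "f \<in> carrier (C n v w)" "g \<in> carrier (C n v w)"
  shows "homology_class R X n v w f = homology_class R X n v w g \<longleftrightarrow>
    (\<exists>b\<in>boundaries R X n v w. g = b \<oplus>\<^bsub>C n v w\<^esub> f)"
  unfolding homology_class_def by (rule coset_eq_iff[OF module_C submodule_boundaries assms])

lemma concat_zero_left:
  assumes "g \<in> carrier (C j v w)"
  shows "concat_chains R X i j u w \<zero>\<^bsub>C i u v\<^esub> g = \<zero>\<^bsub>C (i + j - 1) u w\<^esub>"
  by (rule module_hom_zero[OF module_C module_C concat_hom_left[OF assms]])

lemma concat_zero_right:
  assumes "f \<in> carrier (C i u v)"
  shows "concat_chains R X i j u w f \<zero>\<^bsub>C j v w\<^esub> = \<zero>\<^bsub>C (i + j - 1) u w\<^esub>"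
  by (rule module_hom_zero[OF module_C module_C concat_hom_right[OF assms]])

text \<open>Each term of the Leibniz rule has a zero factor, possibly in the zero module of degree
  0.\<close>

lemma concat_cycles:
  assumes f: "f \<in> cycles R X i u v" and g: "g \<in> cycles R X j v w" and ij: "i \<ge> 1" "j \<ge> 1"
  shows "concat_chains R X i j u w f g \<in> cycles R X (i + j - 1) u w"
proof -
  have deg: "i - 1 + j - 1 = i + j - 1 - 1" "i + (j - 1) - 1 = i + j - 1 - 1" using ij by auto
  let ?N = "C (i + j - 1 - 1) u w"
  interpret N: module R ?N by (rule module_C)
  note f' = cycles_closed[OF f] and g' = cycles_closed[OF g]
  have z: "boundary R X i u v f = \<zero>\<^bsub>C (i - 1) u v\<^esub>" "boundary R X j v w g = \<zero>\<^bsub>C (j - 1) v w\<^esub>"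
    using f g by (simp_all add: cycles_def)
  have "boundary R X (i + j - 1) u w (concat_chains R X i j u w f g) =
      \<zero>\<^bsub>?N\<^esub> \<oplus>\<^bsub>?N\<^esub> dim_sign i \<odot>\<^bsub>?N\<^esub> \<zero>\<^bsub>?N\<^esub>"
    unfolding boundary_concat[OF f' g' ij] z
      concat_zero_left[OF g', of "i - 1", unfolded deg] concat_zero_right[OF f', of "j - 1", unfolded deg] ..
  also have "\<dots> = \<zero>\<^bsub>?N\<^esub>"
    unfolding N.smult_r_null[OF dim_sign_closed] by (rule N.M.l_zero[OF N.M.zero_closed])
  finally show ?thesis
    unfolding cycles_def using module_homD(1)[OF concat_hom_right[OF f'] g'] by simp
qed

text \<open>Apply the Leibniz rule to g and a preimage e of f, one degree higher: since g is a
  cycle, only the unsigned term \<open>f\<close> times \<open>g\<close> survives.\<close>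

lemma concat_boundary_cycle:
  assumes f: "f \<in> boundaries R X i u v" and g: "g \<in> cycles R X j v w" and ij: "i \<ge> 1" "j \<ge> 1"
  shows "concat_chains R X i j u w f g \<in> boundaries R X (i + j - 1) u w"
proof -
  obtain e where e: "e \<in> carrier (C (i + 1) u v)" "f = boundary R X (i + 1) u v e"
    using f by (auto simp: boundaries_def)
  have deg: "i + 1 - 1 = i" "i + 1 + j - 1 = i + j - 1 + 1" "i + 1 + (j - 1) - 1 = i + j - 1"
    "i + j - 1 + 1 - 1 = i + j - 1" "i + 1 \<ge> 1"
    using ij by auto
  let ?N = "C (i + j - 1) u w"
  interpret N: module R ?N by (rule module_C)
  note g' = cycles_closed[OF g]
  have z: "boundary R X j v w g = \<zero>\<^bsub>C (j - 1) v w\<^esub>" using g by (simp add: cycles_def)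
  have f': "f \<in> carrier (C i u v)"
    using module.submoduleE(1)[OF module_C submodule_boundaries] f by blast
  have "boundary R X (i + j - 1 + 1) u w (concat_chains R X (i + 1) j u w e g) =
      concat_chains R X i j u w f g \<oplus>\<^bsub>?N\<^esub> dim_sign (i + 1) \<odot>\<^bsub>?N\<^esub> \<zero>\<^bsub>?N\<^esub>"
    using boundary_concat[OF e(1) g' deg(5) ij(2)]
    unfolding z concat_zero_right[OF e(1)] deg e(2)[symmetric] .
  also have "\<dots> = concat_chains R X i j u w f g"
    unfolding N.smult_r_null[OF dim_sign_closed]
    by (rule N.M.r_zero[OF module_homD(1)[OF concat_hom_right[OF f'] g']])
  finally show ?thesis
    unfolding boundaries_def
    using module_homD(1)[OF concat_hom_right[OF e(1)] g', unfolded deg] by (metis image_eqI)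
qed

text \<open>Here the signed term of the Leibniz rule survives, so at first only a signed product is
  a boundary. Boundaries form a submodule and the sign squares to one, so scaling by it once more
  removes it.\<close>

lemma concat_cycle_boundary:
  assumes f: "f \<in> cycles R X i u v" and g: "g \<in> boundaries R X j v w" and ij: "i \<ge> 1" "j \<ge> 1"
  shows "concat_chains R X i j u w f g \<in> boundaries R X (i + j - 1) u w"
proof -
  obtain e where e: "e \<in> carrier (C (j + 1) v w)" "g = boundary R X (j + 1) v w e"
    using g by (auto simp: boundaries_def)
  have deg: "j + 1 - 1 = j" "i + (j + 1) - 1 = i + j - 1 + 1" "i - 1 + (j + 1) - 1 = i + j - 1"
    "i + j - 1 + 1 - 1 = i + j - 1" "j + 1 \<ge> 1"
    using ij by auto
  let ?N = "C (i + j - 1) u w" and ?fe = "concat_chains R X i (j + 1) u w f e"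
  interpret N: module R ?N by (rule module_C)
  interpret B: submodule "boundaries R X (i + j - 1) u w" R ?N by (rule submodule_boundaries)
  note f' = cycles_closed[OF f]
  have z: "boundary R X i u v f = \<zero>\<^bsub>C (i - 1) u v\<^esub>" using f by (simp add: cycles_def)
  have g': "g \<in> carrier (C j v w)"
    using module.submoduleE(1)[OF module_C submodule_boundaries] g by blast
  have fg: "concat_chains R X i j u w f g \<in> carrier ?N"
    by (rule module_homD(1)[OF concat_hom_right[OF f'] g'])
  have "boundary R X (i + j - 1 + 1) u w ?fe =
      \<zero>\<^bsub>?N\<^esub> \<oplus>\<^bsub>?N\<^esub> dim_sign i \<odot>\<^bsub>?N\<^esub> concat_chains R X i j u w f g"
    using boundary_concat[OF f' e(1) ij(1) deg(5)]
    unfolding z concat_zero_left[OF e(1)] deg e(2)[symmetric] .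
  also have "\<dots> = dim_sign i \<odot>\<^bsub>?N\<^esub> concat_chains R X i j u w f g"
    by (rule N.M.l_zero[OF N.smult_closed[OF dim_sign_closed fg]])
  finally have "dim_sign i \<odot>\<^bsub>?N\<^esub> concat_chains R X i j u w f g \<in> boundaries R X (i + j - 1) u w"
    unfolding boundaries_def
    using module_homD(1)[OF concat_hom_right[OF f'] e(1), unfolded deg] by (metis image_eqI)
  then have "dim_sign i \<odot>\<^bsub>?N\<^esub> (dim_sign i \<odot>\<^bsub>?N\<^esub> concat_chains R X i j u w f g)
      \<in> boundaries R X (i + j - 1) u w"
    by (rule B.smult_closed[OF dim_sign_closed])
  moreover have "dim_sign i \<odot>\<^bsub>?N\<^esub> (dim_sign i \<odot>\<^bsub>?N\<^esub> concat_chains R X i j u w f g) =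
      concat_chains R X i j u w f g"
  proof -
    have "dim_sign i \<otimes> dim_sign i = (\<ominus> \<one>) [^] (2 * (i - 1))"
      unfolding dim_sign_def mult_2 by (rule nat_pow_mult) simp
    then have "dim_sign i \<otimes> dim_sign i = \<one>" unfolding neg_one_pow_even .
    then show ?thesis
      using N.smult_assoc1[OF dim_sign_closed dim_sign_closed fg, of i i] N.smult_one[OF fg] by metis
  qed
  ultimately show ?thesis by metis
qed

text \<open>The representatives are exchanged one at a time. Replacing f changes the product by a
  boundary times a cycle, replacing g afterwards by a cycle times a boundary.\<close>

lemma homology_class_concat_cong:
  assumes f: "f \<in> cycles R X i u v" "f' \<in> cycles R X i u v"
    and g: "g \<in> cycles R X j v w" "g' \<in> cycles R X j v w"
    and ij: "i \<ge> 1" "j \<ge> 1"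
    and eq: "homology_class R X i u v f = homology_class R X i u v f'"
      "homology_class R X j v w g = homology_class R X j v w g'"
  shows "homology_class R X (i + j - 1) u w (concat_chains R X i j u w f g) =
    homology_class R X (i + j - 1) u w (concat_chains R X i j u w f' g')"
proof -
  note cl = cycles_closed[OF f(1)] cycles_closed[OF f(2)] cycles_closed[OF g(1)] cycles_closed[OF g(2)]
  note ccl = module_homD(1)[OF concat_hom_right]
  have bcl: "b \<in> carrier (C n x y)" if "b \<in> boundaries R X n x y" for b n x y
    using module.submoduleE(1)[OF module_C submodule_boundaries] that by blast
  obtain a where a: "a \<in> boundaries R X i u v" "f' = a \<oplus>\<^bsub>C i u v\<^esub> f"
    using eq(1) homology_class_eq_iff[OF cl(1,2)] by auto
  obtain b where b: "b \<in> boundaries R X j v w" "g' = b \<oplus>\<^bsub>C j v w\<^esub> g"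
    using eq(2) homology_class_eq_iff[OF cl(3,4)] by auto
  have "concat_chains R X i j u w f' g = concat_chains R X i j u w a g
      \<oplus>\<^bsub>C (i + j - 1) u w\<^esub> concat_chains R X i j u w f g"
    unfolding a(2) by (rule module_homD(2)[OF concat_hom_left[OF cl(3)] bcl[OF a(1)] cl(1)])
  then have "homology_class R X (i + j - 1) u w (concat_chains R X i j u w f g) =
      homology_class R X (i + j - 1) u w (concat_chains R X i j u w f' g)"
    using homology_class_eq_iff[OF ccl[OF cl(1,3)] ccl[OF cl(2,3)]]
      concat_boundary_cycle[OF a(1) g(1) ij] by blast
  also have "concat_chains R X i j u w f' g' = concat_chains R X i j u w f' b
      \<oplus>\<^bsub>C (i + j - 1) u w\<^esub> concat_chains R X i j u w f' g"
    unfolding b(2) by (rule module_homD(2)[OF concat_hom_right[OF cl(2)] bcl[OF b(1)] cl(3)])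
  then have "homology_class R X (i + j - 1) u w (concat_chains R X i j u w f' g) =
      homology_class R X (i + j - 1) u w (concat_chains R X i j u w f' g')"
    using homology_class_eq_iff[OF ccl[OF cl(2,3)] ccl[OF cl(2,4)]]
      concat_cycle_boundary[OF f(2) b(1) ij] by blast
  finally show ?thesis .
qed

text \<open>The universal property asks for a bilinear function on classes. Linearity of the class
  map on cycles and of concatenation on chains gives it in each argument.\<close>

lemma conc_product:
  assumes ij: "i \<ge> 1" "j \<ge> 1"
  shows "\<exists>!\<Phi>. \<Phi> \<in> linear_maps R (tensor_product R (HM R X i u v) (HM R X j v w)) (HM R X (i + j - 1) u w) \<and>
    (\<forall>c\<in>cycles R X i u v. \<forall>d\<in>cycles R X j v w.
      \<Phi> (pure_tensor R (HM R X i u v) (HM R X j v w)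
          (homology_class R X i u v c) (homology_class R X j v w d)) =
      homology_class R X (i + j - 1) u w (concat_chains R X i j u w c d))"
proof -
  \<comment> \<open>An arbitrary cycle in each class; \<open>homology_class_concat_cong\<close>
    makes the product of classes independent of it.\<close>
  define rep where "rep n v w x = (SOME c. c \<in> cycles R X n v w \<and> homology_class R X n v w c = x)"
    for n v w x
  have rep: "rep n v w (homology_class R X n v w c) \<in> cycles R X n v w"
    "homology_class R X n v w (rep n v w (homology_class R X n v w c)) = homology_class R X n v w c"
    if "c \<in> cycles R X n v w" for n v w c
    unfolding rep_def atomize_conj by (rule someI[of _ c]) (use that in simp)
  define \<beta> where "\<beta> x y =
    homology_class R X (i + j - 1) u w (concat_chains R X i j u w (rep i u v x) (rep j v w y))" for x y
  have \<beta>: "\<beta> (homology_class R X i u v c) (homology_class R X j v w d) =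
      homology_class R X (i + j - 1) u w (concat_chains R X i j u w c d)"
    if "c \<in> cycles R X i u v" "d \<in> cycles R X j v w" for c d
    unfolding \<beta>_def using that rep by (intro homology_class_concat_cong ij) auto
  note ccl = concat_cycles[OF _ _ ij]
  \<comment> \<open>Sums and multiples of cycles are again cycles, so the formula for the product
    applies to their classes.\<close>
  note Z = module.submoduleE(4,5)[OF module_C submodule_cycles]
  note cls = module_homD[OF homology_class_hom, simplified]
  have bil1: "(\<lambda>x. \<beta> x y) \<in> module_hom R (HM R X i u v) (HM R X (i + j - 1) u w)"
    if y: "y \<in> carrier (HM R X j v w)" for y
  proof -
    obtain d where d: "d \<in> cycles R X j v w" "y = homology_class R X j v w d"
      using y by (auto simp: carrier_HM)
    note h = module_homD(2,3)[OF concat_hom_left[OF cycles_closed[OF d(1)]]]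
    show ?thesis unfolding d(2)
      by (rule module_homI) (auto simp: carrier_HM[of i] \<beta> d(1) cls(1) ccl cycles_closed h Z
          simp flip: cls(2,3))
  qed
  have bil2: "\<beta> x \<in> module_hom R (HM R X j v w) (HM R X (i + j - 1) u w)"
    if x: "x \<in> carrier (HM R X i u v)" for x
  proof -
    obtain c where c: "c \<in> cycles R X i u v" "x = homology_class R X i u v c"
      using x by (auto simp: carrier_HM)
    note h = module_homD(2,3)[OF concat_hom_right[OF cycles_closed[OF c(1)]]]
    show ?thesis unfolding c(2)
      by (rule module_homI) (auto simp: carrier_HM[of j] \<beta> c(1) cls(1) ccl[OF c(1)] cycles_closed h Z
          simp flip: cls(2,3))
  qed
  show ?thesis
    using tensor_product_universal[OF module_HM module_HM module_HM bil1 bil2]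
    by (simp add: carrier_HM \<beta>)
qed

end

theorem lemma6p2:
  fixes R :: "('r, 'm) ring_scheme" and X :: "'a precubical"
    and i j :: nat and \<alpha> \<beta> \<gamma> :: 'a
  assumes "field R"
    and "precubical_set X"
    and "finite_precubical X"
    and "\<forall>v\<in>cells X 0. \<forall>w\<in>cells X 0. \<forall>m::nat.
           \<forall>c\<in>cube_chains X v w. \<forall>c'\<in>cube_chains X v w.
             chain_dim c = m \<longrightarrow> chain_dim c' = m \<longrightarrow> chain_length c = chain_length c'"
    and "i \<ge> 1" and "j \<ge> 1"
    and "\<alpha> \<in> cells X 0" and "\<beta> \<in> cells X 0" and "\<gamma> \<in> cells X 0"
    and "reachable X \<alpha> \<beta>" and "reachable X \<beta> \<gamma>"
  shows "(\<forall>c\<in>cycles R X i \<alpha> \<beta>. \<forall>d\<in>cycles R X j \<beta> \<gamma>.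
            concat_chains R X i j \<alpha> \<gamma> c d \<in> cycles R X (i + j - 1) \<alpha> \<gamma>) \<and>
         (\<exists>!\<Phi>. \<Phi> \<in> linear_maps R (tensor_product R (HM R X i \<alpha> \<beta>) (HM R X j \<beta> \<gamma>))
                                  (HM R X (i + j - 1) \<alpha> \<gamma>) \<and>
           (\<forall>c\<in>cycles R X i \<alpha> \<beta>. \<forall>d\<in>cycles R X j \<beta> \<gamma>.
             \<Phi> (pure_tensor R (HM R X i \<alpha> \<beta>) (HM R X j \<beta> \<gamma>)
                  (homology_class R X i \<alpha> \<beta> c) (homology_class R X j \<beta> \<gamma> d)) =
             homology_class R X (i + j - 1) \<alpha> \<gamma> (concat_chains R X i j \<alpha> \<gamma> c d)))"
proof -
  have "cube_chain_complex X R"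
    using assms(1,2) by (simp add: cube_chain_complex_def field_def domain_def)
  then interpret cube_chain_complex X R .
  show ?thesis
  proof (intro conjI ballI)
    fix c d assume "c \<in> cycles R X i \<alpha> \<beta>" "d \<in> cycles R X j \<beta> \<gamma>"
    then show "concat_chains R X i j \<alpha> \<gamma> c d \<in> cycles R X (i + j - 1) \<alpha> \<gamma>"
      using assms(5,6) by (rule concat_cycles)
  qed (rule conc_product[OF assms(5,6)])
qed

end
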